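(* Let $f:\mathbb{R}\to\mathbb{C}$ be a $2$-periodic function with $f\in L^2(0,1)$. Assume that the Fourier coefficients of $f$ are such that $|\hat f(j)|\le \phi_j$ for all $j\in\mathbb{N}$, for a sequence $\{\phi_j\}_{j=1}^\infty\in\ell^1(\mathbb{N})$, and let $\varphi=\sum_{j=1}^\infty\phi_j$. Let $\mathcal{F}\subset\mathbb{N}$ be a finite set such that $1\in\mathcal{F}$, let $\mathfrak{p}_1<\dots<\mathfrak{p}_d$ be the primes dividing at least one element of $\mathcal{F}$, and let $$\mu=\min_{w\in\mathbb{T}^d}\left|\sum_{j\in\mathcal{F}}\hat f(j)\,w_1^{\nu_{\mathfrak{p}_1}(j)}\cdots w_d^{\nu_{\mathfrak{p}_d}(j)}\right|.$$ Let $k\in\mathbb{N}$. If $$\sum_{j\in\mathcal{F}\setminus\{1\}}|\hat f(j)|<\hat f(1)$$ and $$\mu-\varphi+\sum_{j\in\mathcal{F}}|\hat f(j)|+\sum_{j=1}^k\left(\phi_j-|\hat f(j)|\right)>0,$$ then the families $\mathfrak{E}_f$ and $\mathfrak{E}_{\operatorname{s}}$ are fully equivalent.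
   Context: $\mathbb{N}=\{1,2,\dots\}$. The (sine) Fourier coefficients of $f$ are $\hat f(j)=2\int_0^1 f(x)\sin(j\pi x)\,\mathrm{d}x$, $j\in\mathbb{N}$. For a $2$-periodic function $f$ put $f_n(x)=f(nx)$ and $\mathfrak{E}_f=\{f_n\}_{n=1}^\infty$, regarded as a sequence in $L^2(0,1)$. Write $\operatorname{s}(x)=\sin(\pi x)$, so that $\mathfrak{E}_{\operatorname{s}}=\{\sin(n\pi x)\}_{n=1}^\infty$. Two sequences $\{f_n\},\{g_n\}\subset L^2(0,1)$ are fully equivalent if there is a linear homeomorphism $T:L^2(0,1)\to L^2(0,1)$ with $Tg_n=f_n$ for all $n$. For a prime $\mathfrak{p}$ and $n\in\mathbb{N}$, $\nu_{\mathfrak{p}}(n)\ge 0$ is the exponent of $\mathfrak{p}$ in the prime factorisation of $n$ (so all exponents are $0$ for $n=1$). $\mathbb{T}^d=\{(w_1,\dots,w_d)\in\mathbb{C}^d: |w_j|=1 \text{ for all } j=1,\dots,d\}$ and $w=(w_1,\dots,w_d)$. The case $d=0$, i.e. $\mathcal{F}=\{1\}$, is allowed; then the expression inside the modulus is the constant $\hat f(1)$ and $\mu=|\hat f(1)|$.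
   Formalization: The formal theorem also assumes that f is odd almost everywhere (f(-x) = -f(x)); without this the claim fails, e.g. for f(x) = |sin(πx)| with F = {1} and φ = (1,0,0,…). *)

theory Defs
  imports "HOL-Analysis.Analysis" "HOL-Computational_Algebra.Primes"
begin

abbreviation M01 :: "real measure" where
  "M01 \<equiv> lebesgue_on {0<..<1}"

definition square_integrable :: "(real \<Rightarrow> complex) \<Rightarrow> bool" where
  "square_integrable u \<longleftrightarrow>
     u \<in> borel_measurable M01 \<and> integrable M01 (\<lambda>x. (norm (u x))\<^sup>2)"

definition L2_rel :: "(real \<Rightarrow> complex) \<Rightarrow> (real \<Rightarrow> complex) \<Rightarrow> bool" where
  "L2_rel u v \<longleftrightarrow> square_integrable u \<and> square_integrable v \<and> (AE x in M01. u x = v x)"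

lemma square_integrable_zero: "square_integrable (\<lambda>_. 0)"
  by (simp add: square_integrable_def)

lemma square_integrable_scale:
  assumes "square_integrable u"
  shows "square_integrable (\<lambda>x. c * u x)"
  using assms by (auto simp: square_integrable_def norm_mult power_mult_distrib)

lemma square_integrable_add:
  assumes "square_integrable u" "square_integrable v"
  shows "square_integrable (\<lambda>x. u x + v x)"
proof -
  have [measurable]: "u \<in> borel_measurable M01" "v \<in> borel_measurable M01"
    using assms by (auto simp: square_integrable_def)
  have "integrable M01 (\<lambda>x. 2 * (norm (u x))\<^sup>2 + 2 * (norm (v x))\<^sup>2)"
    using assms by (auto simp: square_integrable_def)
  then have "integrable M01 (\<lambda>x. (norm (u x + v x))\<^sup>2)"
  proof (rule Bochner_Integration.integrable_bound)
    have "(norm (u x + v x))\<^sup>2 \<le> 2 * (norm (u x))\<^sup>2 + 2 * (norm (v x))\<^sup>2" for x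
    proof -
      have "(norm (u x + v x))\<^sup>2 \<le> (norm (u x) + norm (v x))\<^sup>2"
        by (intro power_mono norm_triangle_ineq) auto
      also have "\<dots> \<le> 2 * (norm (u x))\<^sup>2 + 2 * (norm (v x))\<^sup>2"
        using sum_squares_bound[of "norm (u x)" "norm (v x)"] by (simp add: power2_sum)
      finally show ?thesis .
    qed
    then show "AE x in M01. norm ((norm (u x + v x))\<^sup>2)
        \<le> norm (2 * (norm (u x))\<^sup>2 + 2 * (norm (v x))\<^sup>2)"
      by (intro AE_I2) (auto simp: abs_of_nonneg)
  qed measurable
  then show ?thesis by (simp add: square_integrable_def)
qed

lemma integrable_inner_square_integrable:
  assumes "square_integrable u" "square_integrable v"
  shows "integrable M01 (\<lambda>x. u x \<bullet> v x)"
proof -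
  have [measurable]: "u \<in> borel_measurable M01" "v \<in> borel_measurable M01"
    using assms by (auto simp: square_integrable_def)
  have "integrable M01 (\<lambda>x. (norm (u x))\<^sup>2 + (norm (v x))\<^sup>2)"
    using assms by (auto simp: square_integrable_def)
  then show ?thesis
  proof (rule Bochner_Integration.integrable_bound)
    have "\<bar>u x \<bullet> v x\<bar> \<le> (norm (u x))\<^sup>2 + (norm (v x))\<^sup>2" for x
    proof -
      have "\<bar>u x \<bullet> v x\<bar> \<le> norm (u x) * norm (v x)"
        by (rule Cauchy_Schwarz_ineq2)
      also have "\<dots> \<le> 2 * norm (u x) * norm (v x)" by simp
      also have "\<dots> \<le> (norm (u x))\<^sup>2 + (norm (v x))\<^sup>2"
        by (rule sum_squares_bound)
      finally show ?thesis .
    qed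
    then show "AE x in M01. norm (u x \<bullet> v x) \<le> norm ((norm (u x))\<^sup>2 + (norm (v x))\<^sup>2)"
      by (intro AE_I2) (auto simp: abs_of_nonneg)
  qed measurable
qed

quotient_type L2 = "real \<Rightarrow> complex" / partial: L2_rel
proof (rule part_equivpI)
  show "\<exists>u. L2_rel u u"
    by (rule exI[of _ "\<lambda>_. 0"]) (simp add: L2_rel_def square_integrable_zero)
  show "symp L2_rel"
    by (rule sympI) (auto simp: L2_rel_def elim: eventually_mono)
  show "transp L2_rel"
    by (rule transpI) (auto simp: L2_rel_def elim: eventually_elim2)
qed

lift_definition scaleC :: "complex \<Rightarrow> L2 \<Rightarrow> L2" is "\<lambda>c u x. c * u x"
  by (auto simp: L2_rel_def square_integrable_scale elim: eventually_mono)

instantiation L2 :: real_inner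
begin

lift_definition zero_L2 :: L2 is "\<lambda>_. 0"
  by (simp add: L2_rel_def square_integrable_zero)

lift_definition plus_L2 :: "L2 \<Rightarrow> L2 \<Rightarrow> L2" is "\<lambda>u v x. u x + v x"
  by (auto simp: L2_rel_def square_integrable_add elim: eventually_elim2)

definition uminus_L2 :: "L2 \<Rightarrow> L2" where "- x = scaleC (- 1) x"

definition minus_L2 :: "L2 \<Rightarrow> L2 \<Rightarrow> L2" where "x - y = x + - (y :: L2)"

definition scaleR_L2 :: "real \<Rightarrow> L2 \<Rightarrow> L2" where "r *\<^sub>R x = scaleC (of_real r) x"

(* On complex the library's inner product is Re (a * cnj b), so that the induced norm is the
   usual one, the square root of the integral of |u|^2. *)
lift_definition inner_L2 :: "L2 \<Rightarrow> L2 \<Rightarrow> real" is "\<lambda>u v. \<integral>x. u x \<bullet> v x \<partial>M01"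
proof -
  fix u u' v v' assume *: "L2_rel u u'" "L2_rel v v'"
  then have [measurable]: "u \<in> borel_measurable M01" "v \<in> borel_measurable M01"
    "u' \<in> borel_measurable M01" "v' \<in> borel_measurable M01"
    by (auto simp: L2_rel_def square_integrable_def)
  show "(\<integral>x. u x \<bullet> v x \<partial>M01) = (\<integral>x. u' x \<bullet> v' x \<partial>M01)"
    using * by (intro integral_cong_AE) (auto simp: L2_rel_def elim: eventually_elim2)
qed

definition norm_L2 :: "L2 \<Rightarrow> real" where "norm x = sqrt (x \<bullet> (x :: L2))"

definition sgn_L2 :: "L2 \<Rightarrow> L2" where "sgn x = scaleC (of_real (inverse (norm (x :: L2)))) x"

definition dist_L2 :: "L2 \<Rightarrow> L2 \<Rightarrow> real" where "dist x y = norm (x - y :: L2)"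

definition uniformity_L2 :: "(L2 \<times> L2) filter" where
  "uniformity_L2 = (INF e\<in>{0<..}. principal {(x, y). dist x (y :: L2) < e})"

definition open_L2 :: "L2 set \<Rightarrow> bool" where
  "open_L2 U = (\<forall>x\<in>U. eventually (\<lambda>(x', y). x' = x \<longrightarrow> y \<in> U) uniformity)"

instance
proof
  fix x y z :: L2 and a b :: real
  show "x + y + z = x + (y + z)"
    by transfer (auto simp: L2_rel_def square_integrable_add add.assoc)
  show "x + y = y + x"
    by transfer (auto simp: L2_rel_def square_integrable_add add.commute)
  show "0 + x = x"
    by transfer (auto simp: L2_rel_def)
  show "- x + x = 0"
    unfolding uminus_L2_def
    by transfer (auto simp: L2_rel_def square_integrable_zero)
  show "x - y = x + - y" by (simp add: minus_L2_def)
  show "a *\<^sub>R (x + y) = a *\<^sub>R x + a *\<^sub>R y"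
    unfolding scaleR_L2_def
    by transfer (auto simp: L2_rel_def distrib_left intro!: square_integrable_add square_integrable_scale)
  show "(a + b) *\<^sub>R x = a *\<^sub>R x + b *\<^sub>R x"
    unfolding scaleR_L2_def
    by transfer (auto simp: L2_rel_def distrib_right intro!: square_integrable_add square_integrable_scale)
  show "a *\<^sub>R b *\<^sub>R x = (a * b) *\<^sub>R x"
    unfolding scaleR_L2_def
    by transfer (auto simp: L2_rel_def mult.assoc intro!: square_integrable_scale)
  show "1 *\<^sub>R x = x"
    unfolding scaleR_L2_def by transfer (auto simp: L2_rel_def)
  show "x \<bullet> y = y \<bullet> x"
    by transfer (simp add: inner_commute)
  show "(x + y) \<bullet> z = x \<bullet> z + y \<bullet> z"
    by transfer (auto simp: inner_add_left L2_rel_def integrable_inner_square_integrable)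
  show "a *\<^sub>R x \<bullet> y = a * (x \<bullet> y)"
    unfolding scaleR_L2_def
    by transfer (auto simp flip: scaleR_conv_of_real)
  show "0 \<le> x \<bullet> x"
    by transfer simp
  show "(x \<bullet> x = 0) = (x = 0)"
  proof transfer
    fix u :: "real \<Rightarrow> complex" assume "L2_rel u u"
    then have u: "square_integrable u" by (simp add: L2_rel_def)
    have "(\<integral>x. u x \<bullet> u x \<partial>M01) = 0 \<longleftrightarrow> (AE x in M01. u x \<bullet> u x = 0)"
      using integrable_inner_square_integrable[OF u u]
      by (intro integral_nonneg_eq_0_iff_AE) auto
    then show "((\<integral>x. u x \<bullet> u x \<partial>M01) = 0) = L2_rel u (\<lambda>_. 0)"
      using u by (simp add: L2_rel_def square_integrable_zero)
  qed
qed (simp_all only: norm_L2_def sgn_L2_def scaleR_L2_def dist_L2_def uniformity_L2_def open_L2_def)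

end

lemma vector_space_scaleC: "vector_space scaleC"
proof
  fix a b :: complex and x y :: L2
  show "scaleC a (x + y) = scaleC a x + scaleC a y"
    by transfer (auto simp: L2_rel_def distrib_left intro!: square_integrable_add square_integrable_scale)
  show "scaleC (a + b) x = scaleC a x + scaleC b x"
    by transfer (auto simp: L2_rel_def distrib_right intro!: square_integrable_add square_integrable_scale)
  show "scaleC a (scaleC b x) = scaleC (a * b) x"
    by transfer (auto simp: L2_rel_def mult.assoc intro!: square_integrable_scale)
  show "scaleC 1 x = x"
    by transfer (auto simp: L2_rel_def)
qed

(* abs_L2 u is the class of u, and is meaningful only for square integrable u; hence the
   explicit membership requirement. Sequences are indexed by n = 1, 2, ... *)
definition fully_equivalent ::
  "(nat \<Rightarrow> real \<Rightarrow> complex) \<Rightarrow> (nat \<Rightarrow> real \<Rightarrow> complex) \<Rightarrow> bool" where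
  "fully_equivalent F G \<longleftrightarrow>
     (\<forall>n\<ge>1. square_integrable (F n) \<and> square_integrable (G n)) \<and>
     (\<exists>T S. Vector_Spaces.linear scaleC scaleC T \<and> homeomorphism UNIV UNIV T S \<and>
            (\<forall>n\<ge>1. T (abs_L2 (G n)) = abs_L2 (F n)))"

definition fourier_sin :: "(real \<Rightarrow> complex) \<Rightarrow> nat \<Rightarrow> complex" where
  "fourier_sin f j = 2 * (\<integral>x. f x * of_real (sin (real j * pi * x)) \<partial>M01)"

(* For n > 1 the restriction of f(nx) to (0,1) depends on f outside (0,1), about which the sine
   coefficients carry information only if f is the odd 2-periodic extension of its restriction. *)
definition dilations :: "(real \<Rightarrow> complex) \<Rightarrow> nat \<Rightarrow> real \<Rightarrow> complex" where
  "dilations f n = (\<lambda>x. f (real n * x))"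

definition sine :: "real \<Rightarrow> complex" where
  "sine x = of_real (sin (pi * x))"

definition primes_of :: "nat set \<Rightarrow> nat list" where
  "primes_of F = sorted_list_of_set {p. prime p \<and> (\<exists>j\<in>F. p dvd j)}"

definition torus :: "nat \<Rightarrow> (nat \<Rightarrow> complex) set" where
  "torus d = {..<d} \<rightarrow>\<^sub>E {z. norm z = 1}"

definition torus_poly :: "(nat \<Rightarrow> complex) \<Rightarrow> nat set \<Rightarrow> (nat \<Rightarrow> complex) \<Rightarrow> complex" where
  "torus_poly a F w =
     (\<Sum>j\<in>F. a j * (\<Prod>i<length (primes_of F). w i ^ multiplicity (primes_of F ! i) j))"

definition torus_min :: "(nat \<Rightarrow> complex) \<Rightarrow> nat set \<Rightarrow> real" where
  "torus_min a F =
     (LEAST m. m \<in> (\<lambda>w. norm (torus_poly a F w)) ` torus (length (primes_of F)))"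

lemma torus_min_attained:
  obtains w where "w \<in> torus (length (primes_of F))" "norm (torus_poly a F w) = torus_min a F"
    and "\<And>v. v \<in> torus (length (primes_of F)) \<Longrightarrow> torus_min a F \<le> norm (torus_poly a F v)"
proof -
  let ?d = "length (primes_of F)"
  let ?X = "product_topology (\<lambda>_. euclidean) {..<?d} :: (nat \<Rightarrow> complex) topology"
  let ?N = "\<lambda>w. norm (torus_poly a F w)"
  have "{z :: complex. norm z = 1} = sphere 0 1" by auto
  then have cpt: "compactin ?X (torus ?d)"
    by (simp add: torus_def compactin_PiE)
  have proj: "continuous_map ?X euclidean (\<lambda>w. w i ^ m)" if "i < ?d" for i m
    using continuous_map_product_projection[of i "{..<?d}" "\<lambda>_. euclidean :: complex topology"] that
    by (induction m) (auto simp: o_def continuous_map_atin intro!: tendsto_mult)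
  have "continuous_map ?X euclidean (torus_poly a F)"
    unfolding torus_poly_def[abs_def] continuous_map_atin
    using proj by (auto simp: continuous_map_atin intro!: tendsto_sum tendsto_mult tendsto_prod)
  then have "continuous_map ?X euclidean ?N"
    by (auto simp: continuous_map_atin intro!: tendsto_norm)
  then have "compact (?N ` torus ?d)"
    using image_compactin[OF cpt] by (metis compactin_euclidean_iff)
  moreover have "(\<lambda>i\<in>{..<?d}. 1) \<in> torus ?d" by (auto simp: torus_def)
  ultimately obtain m where m: "m \<in> ?N ` torus ?d" "\<And>t. t \<in> ?N ` torus ?d \<Longrightarrow> m \<le> t"
    using compact_attains_inf[of "?N ` torus ?d"] by blast
  then have "torus_min a F = m"
    unfolding torus_min_def by (intro Least_equality) auto
  with m show thesis by (auto intro: that)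
qed

end

theory Submission
  imports Defs
begin

text \<open>
  Write \<open>e\<^sub>n\<close> for the class of \<open>sin (n \<pi> x)\<close>, \<open>a\<^sub>j\<close> for the sine coefficients of \<open>f\<close> and \<open>D\<^sub>j\<close> for the
  operator that extends a function on \<open>(0,1)\<close> to an odd 2-periodic one and replaces \<open>x\<close> by \<open>j x\<close>.
  Each \<open>D\<^sub>j\<close> is a linear isometry of \<open>L\<^sup>2(0,1)\<close> with \<open>D\<^sub>j e\<^sub>n = e\<^sub>j\<^sub>n\<close>. Since the coefficients are
  absolutely summable, \<open>T = \<Sum>\<^sub>j a\<^sub>j D\<^sub>j\<close> converges in operator norm, and as \<open>f = \<Sum>\<^sub>j a\<^sub>j e\<^sub>j\<close>,
  \<open>T e\<^sub>n = \<Sum>\<^sub>j a\<^sub>j e\<^sub>j\<^sub>n = D\<^sub>n f\<close>, which is the class of \<open>f(n x)\<close> because \<open>f\<close> is odd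
  and 2-periodic. So it remains to see that \<open>T\<close> is bijective and bounded below (\<open>homeomorphism_of_bounded_below\<close>).

  Split \<open>T = A + B\<close> into the terms with \<open>j \<in> F\<close> and the others. The heart of the matter is the bound
  \<open>\<parallel>A u\<parallel> \<ge> \<mu> \<parallel>u\<parallel>\<close>. It is Bohr's correspondence: on a finite sum \<open>u = \<Sum>\<^sub>n c\<^sub>n e\<^sub>n\<close> the operator \<open>A\<close> acts
  on coefficients as multiplication of the Dirichlet polynomial \<open>\<Sum>\<^sub>n c\<^sub>n n\<^sup>i\<^sup>t\<close> by \<open>\<Sum>\<^sub>j\<^sub>\<in>\<^sub>F a\<^sub>j j\<^sup>i\<^sup>t\<close>. The
  squared norm of \<open>u\<close> is, up to a constant, the mean over \<open>t\<close> of the squared modulus of its Dirichlet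
  polynomial (\<open>norm_sine_sum_mean\<close>), and \<open>\<Sum>\<^sub>j\<^sub>\<in>\<^sub>F a\<^sub>j j\<^sup>i\<^sup>t\<close> is the value of the torus polynomial at the point
  \<open>w\<^sub>i = p\<^sub>i\<^sup>i\<^sup>t\<close>, hence at least \<open>\<mu>\<close> in modulus (\<open>torus_min_le_dirichlet\<close>). Finite sums are dense
  (\<open>closure_sine_span\<close>), so the bound holds everywhere (\<open>dilation_polynomial_lower_bound\<close>).

  Dominance of the first coefficient makes \<open>A\<close> a perturbation of \<open>a\<^sub>1\<close> times the identity by an operator of
  norm less than \<open>\<bar>a\<^sub>1\<bar>\<close>, so \<open>A\<close> is onto. The positivity hypothesis gives
  \<open>\<parallel>B\<parallel> \<le> \<Sum>\<^sub>j\<^sub>\<notin>\<^sub>F \<bar>a\<^sub>j\<bar> < \<mu>\<close>: bounding the coefficients beyond \<open>k\<close> by \<open>\<phi>\<close> shows that the sum over the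
  complement of \<open>F\<close> is at most \<open>\<Sum>\<^sub>j \<phi>\<^sub>j - \<Sum>\<^sub>j\<^sub>\<le>\<^sub>k (\<phi>\<^sub>j - \<bar>a\<^sub>j\<bar>) - \<Sum>\<^sub>j\<^sub>\<in>\<^sub>F \<bar>a\<^sub>j\<bar>\<close>. Therefore \<open>T = A + B\<close> is onto, again by
  perturbation (\<open>surj_add_of_norm_less\<close>), and bounded below by \<open>\<mu> - \<parallel>B\<parallel>\<close>. The perturbation argument
  is a fixed point argument and needs completeness of \<open>L\<^sup>2(0,1)\<close>.
\<close>

section \<open>The space of square integrable functions\<close>

interpretation L2: vector_space scaleC
  by (rule vector_space_scaleC)

lemma L2_exhaust:
  obtains u where "square_integrable u" "X = abs_L2 u"
  using Quotient_rep_abs[OF Quotient_L2] Quotient_rep_reflp[OF Quotient_L2, of X]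
    Quotient_abs_rep[OF Quotient_L2, of X]
  by (metis L2_rel_def)

lemma abs_L2_eqI:
  assumes "square_integrable u" "square_integrable v" "AE x in M01. u x = v x"
  shows "abs_L2 u = abs_L2 v"
  using assms Quotient_rel_abs[OF Quotient_L2] by (simp add: L2_rel_def)

lemma abs_L2_add:
  assumes "square_integrable u" "square_integrable v"
  shows "abs_L2 (\<lambda>x. u x + v x) = abs_L2 u + abs_L2 v"
  using assms by (subst plus_L2.abs_eq) (auto simp: L2_rel_def)

lemma abs_L2_scale:
  assumes "square_integrable u"
  shows "abs_L2 (\<lambda>x. c * u x) = scaleC c (abs_L2 u)"
  using assms by (subst scaleC.abs_eq) (auto simp: L2_rel_def)

lemma square_integrable_diff:
  assumes "square_integrable u" "square_integrable v"
  shows "square_integrable (\<lambda>x. u x - v x)"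
  using square_integrable_add[OF assms(1) square_integrable_scale[OF assms(2), of "-1"]] by simp

lemma abs_L2_diff:
  assumes "square_integrable u" "square_integrable v"
  shows "abs_L2 (\<lambda>x. u x - v x) = abs_L2 u - abs_L2 v"
  using abs_L2_add[OF assms(1) square_integrable_scale[OF assms(2), of "-1"]]
    abs_L2_scale[OF assms(2), of "-1"]
  by (simp flip: uminus_L2_def)

lemma abs_L2_zero: "abs_L2 (\<lambda>x. 0) = 0"
  by (simp add: zero_L2_def)

lemma square_integrable_sum:
  assumes "\<And>i. i \<in> I \<Longrightarrow> square_integrable (u i)"
  shows "square_integrable (\<lambda>x. \<Sum>i\<in>I. u i x)"
  using assms
  by (induction I rule: infinite_finite_induct)
    (auto simp: square_integrable_zero intro!: square_integrable_add)

lemma abs_L2_sum: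
  assumes "\<And>i. i \<in> I \<Longrightarrow> square_integrable (u i)"
  shows "abs_L2 (\<lambda>x. \<Sum>i\<in>I. u i x) = (\<Sum>i\<in>I. abs_L2 (u i))"
  using assms
  by (induction I rule: infinite_finite_induct)
    (auto simp: abs_L2_zero abs_L2_add square_integrable_sum)

lemma inner_abs_L2:
  assumes "square_integrable u" "square_integrable v"
  shows "abs_L2 u \<bullet> abs_L2 v = (\<integral>x. u x \<bullet> v x \<partial>M01)"
  using assms by (subst inner_L2.abs_eq) (auto simp: L2_rel_def)

lemma norm_abs_L2:
  assumes "square_integrable u"
  shows "(norm (abs_L2 u))\<^sup>2 = (\<integral>x. (norm (u x))\<^sup>2 \<partial>M01)"
  using inner_abs_L2[OF assms assms] by (simp add: power2_norm_eq_inner)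

lemma norm_scaleC: "norm (scaleC c X) = norm c * norm X"
proof -
  obtain u where u: "square_integrable u" "X = abs_L2 u"
    by (rule L2_exhaust)
  have "(norm (scaleC c X))\<^sup>2 = (norm c * norm X)\<^sup>2"
    using u norm_abs_L2[OF square_integrable_scale[OF u(1)], of c]
    by (simp add: abs_L2_scale power_mult_distrib norm_mult norm_abs_L2)
  then show ?thesis by (simp add: power2_eq_iff_nonneg)
qed

lemma scaleR_eq_scaleC: "r *\<^sub>R x = scaleC (of_real r) (x :: L2)"
  by (simp add: scaleR_L2_def)

lemma bounded_linear_scaleC: "bounded_linear (scaleC c)"
  by (rule bounded_linear_intro[where K = "norm c"])
    (auto simp: L2.scale_right_distrib scaleR_eq_scaleC norm_scaleC mult.commute)

lemma finite_measure_M01: "finite_measure M01"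
  by (rule finite_measure_lebesgue_on) simp

lemma square_integrable_bounded:
  assumes "u \<in> borel_measurable M01" "\<And>x. x \<in> {0<..<1} \<Longrightarrow> norm (u x) \<le> B"
  shows "square_integrable u"
proof -
  interpret finite_measure M01 by (rule finite_measure_M01)
  have "integrable M01 (\<lambda>x. (norm (u x))\<^sup>2)"
    using assms by (intro integrable_const_bound[of _ "B\<^sup>2"] AE_I2) (auto intro: power_mono)
  with assms(1) show ?thesis by (simp add: square_integrable_def)
qed

lemma square_integrable_cong_AE:
  assumes "square_integrable u" "v \<in> borel_measurable M01" "AE x in M01. u x = v x"
  shows "square_integrable v"
proof -
  have "integrable M01 (\<lambda>x. (norm (v x))\<^sup>2)"
  proof (rule integrable_cong_AE_imp)
    show "integrable M01 (\<lambda>x. (norm (u x))\<^sup>2)"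
      using assms(1) by (simp add: square_integrable_def)
    show "(\<lambda>x. (norm (v x))\<^sup>2) \<in> borel_measurable M01" using assms(2) by measurable
    show "AE x in M01. (norm (u x))\<^sup>2 = (norm (v x))\<^sup>2"
      using assms(3) by eventually_elim simp
  qed
  with assms show ?thesis by (simp add: square_integrable_def)
qed

lemma nn_integral_norm_sq:
  assumes "square_integrable u"
  shows "(\<integral>\<^sup>+x. ennreal ((norm (u x))\<^sup>2) \<partial>M01) = ennreal ((norm (abs_L2 u))\<^sup>2)"
  using assms by (simp add: norm_abs_L2 nn_integral_eq_integral square_integrable_def)

text \<open>
  Dominated convergence in \<open>L\<^sup>2\<close>: the integrand \<open>\<bar>u\<^sub>n - v\<bar>\<^sup>2\<close> is dominated by \<open>4 \<bar>w\<bar>\<^sup>2\<close>.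
\<close>
lemma abs_L2_tendsto_dominated:
  assumes u: "\<And>n::nat. square_integrable (u n)" and v: "v \<in> borel_measurable M01"
    and w: "square_integrable w"
    and lim: "AE x in M01. (\<lambda>n. u n x) \<longlonglongrightarrow> v x"
    and dom: "\<And>n. AE x in M01. norm (u n x) \<le> norm (w x)"
  shows "square_integrable v" "(\<lambda>n. abs_L2 (u n)) \<longlonglongrightarrow> abs_L2 v"
proof -
  have [measurable]: "\<And>n. u n \<in> borel_measurable M01" "v \<in> borel_measurable M01"
    "w \<in> borel_measurable M01" using u v w by (auto simp: square_integrable_def)
  have all: "AE x in M01. \<forall>n. norm (u n x) \<le> norm (w x)"
    using dom by (simp add: AE_all_countable)
  have vw: "AE x in M01. norm (v x) \<le> norm (w x)"
    using all lim
  proof eventually_elim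
    case (elim x)
    then show ?case
      by (intro LIMSEQ_le_const2[OF tendsto_norm[OF elim(2)]]) auto
  qed
  have intw: "integrable M01 (\<lambda>x. (norm (w x))\<^sup>2)" using w by (simp add: square_integrable_def)
  have "integrable M01 (\<lambda>x. (norm (v x))\<^sup>2)"
  proof (rule Bochner_Integration.integrable_bound[OF intw])
    show "AE x in M01. norm ((norm (v x))\<^sup>2) \<le> norm ((norm (w x))\<^sup>2)"
      using vw by eventually_elim (auto intro: power_mono)
  qed measurable
  then show sv: "square_integrable v" using v by (simp add: square_integrable_def)
  have "(\<lambda>n. \<integral>x. (norm (u n x - v x))\<^sup>2 \<partial>M01) \<longlonglongrightarrow> (\<integral>x. 0 \<partial>M01)"
  proof (rule integral_dominated_convergence[where w = "\<lambda>x. 4 * (norm (w x))\<^sup>2"])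
    show "AE x in M01. (\<lambda>n. (norm (u n x - v x))\<^sup>2) \<longlonglongrightarrow> 0"
      using lim
    proof eventually_elim
      case (elim x)
      then have "(\<lambda>n. (norm (u n x - v x))\<^sup>2) \<longlonglongrightarrow> (norm (v x - v x))\<^sup>2"
        by (intro tendsto_intros)
      then show ?case by simp
    qed
    show "AE x in M01. norm ((norm (u n x - v x))\<^sup>2) \<le> 4 * (norm (w x))\<^sup>2" for n
      using all vw
    proof eventually_elim
      case (elim x)
      have "norm (u n x - v x) \<le> 2 * norm (w x)"
        using norm_triangle_ineq4[of "u n x" "v x"] elim by (smt (verit))
      then have "(norm (u n x - v x))\<^sup>2 \<le> (2 * norm (w x))\<^sup>2"
        by (intro power_mono) auto
      then show ?case by (simp add: power_mult_distrib)
    qed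
    show "integrable M01 (\<lambda>x. 4 * (norm (w x))\<^sup>2)" using intw by simp
  qed measurable
  also have "(\<lambda>n. \<integral>x. (norm (u n x - v x))\<^sup>2 \<partial>M01) = (\<lambda>n. (norm (abs_L2 (u n) - abs_L2 v))\<^sup>2)"
    using norm_abs_L2[OF square_integrable_diff[OF u sv]] by (simp add: abs_L2_diff u sv)
  finally have "(\<lambda>n. (norm (abs_L2 (u n) - abs_L2 v))\<^sup>2) \<longlonglongrightarrow> 0" by simp
  then have "(\<lambda>n. sqrt ((norm (abs_L2 (u n) - abs_L2 v))\<^sup>2)) \<longlonglongrightarrow> sqrt 0"
    by (rule tendsto_real_sqrt)
  then show "(\<lambda>n. abs_L2 (u n)) \<longlonglongrightarrow> abs_L2 v"
    by (simp add: tendsto_norm_zero_iff LIM_zero_iff)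
qed

text \<open>
  The interval has measure 1, so the \<open>L\<^sup>1\<close> norm is at most the \<open>L\<^sup>2\<close> norm. Instead of the
  Cauchy--Schwarz inequality, the proof integrates \<open>\<bar>d\<bar> \<le> \<bar>d\<bar>\<^sup>2 / (2c) + c / 2\<close>.
\<close>
lemma nn_integral_norm_le:
  assumes "square_integrable d" "norm (abs_L2 d) \<le> c" "c > 0"
  shows "(\<integral>\<^sup>+x. ennreal (norm (d x)) \<partial>M01) \<le> ennreal c"
proof -
  interpret finite_measure M01 by (rule finite_measure_M01)
  have [measurable]: "d \<in> borel_measurable M01" using assms by (auto simp: square_integrable_def)
  have int: "integrable M01 (\<lambda>x. (norm (d x))\<^sup>2)" using assms by (auto simp: square_integrable_def)
  have "norm (d x) \<le> (norm (d x))\<^sup>2 / (2 * c) + c / 2" for x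
    using sum_squares_bound[of "norm (d x)" c] assms(3) by (simp add: field_simps power2_eq_square)
  then have "(\<integral>\<^sup>+x. ennreal (norm (d x)) \<partial>M01)
      \<le> (\<integral>\<^sup>+x. ennreal ((norm (d x))\<^sup>2 / (2 * c) + c / 2) \<partial>M01)"
    by (intro nn_integral_mono ennreal_leI)
  also have "\<dots> = ennreal (\<integral>x. (norm (d x))\<^sup>2 / (2 * c) + c / 2 \<partial>M01)"
    using assms int by (intro nn_integral_eq_integral) auto
  also have "(\<integral>x. (norm (d x))\<^sup>2 / (2 * c) + c / 2 \<partial>M01) = (norm (abs_L2 d))\<^sup>2 / (2 * c) + c / 2"
    using int by (simp add: norm_abs_L2 assms measure_restrict_space)
  also have "ennreal \<dots> \<le> ennreal c"
  proof (rule ennreal_leI)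
    have "(norm (abs_L2 d))\<^sup>2 \<le> c\<^sup>2" using assms by (intro power_mono) auto
    then show "(norm (abs_L2 d))\<^sup>2 / (2 * c) + c / 2 \<le> c"
      using assms(3) by (simp add: field_simps power2_eq_square)
  qed
  finally show ?thesis .
qed

text \<open>
  The Riesz--Fischer theorem. A subsequence whose successive distances are at most \<open>2\<^sup>-\<^sup>k\<close> has
  increments that are summable in \<open>L\<^sup>1\<close>, hence converges almost everywhere; Fatou's lemma turns the
  Cauchy estimates into an \<open>L\<^sup>2\<close> estimate for the distance to the pointwise limit.
\<close>
instance L2 :: complete_space
proof
  fix X :: "nat \<Rightarrow> L2"
  assume C: "Cauchy X"
  have "\<exists>r::nat \<Rightarrow> nat. strict_mono r \<and> (\<forall>k. \<forall>m\<ge>r k. norm (X m - X (r k)) < (1/2)^k)"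
  proof -
    have "\<exists>N. \<forall>m\<ge>N. \<forall>n\<ge>N. norm (X m - X n) < (1/2)^k" for k :: nat
      using C unfolding Cauchy_iff by (meson zero_less_power half_gt_zero_iff zero_less_one)
    then obtain N where N: "\<And>k m n. m \<ge> N k \<Longrightarrow> n \<ge> N k \<Longrightarrow> norm (X m - X n) < (1/2)^k"
      by metis
    define r where "r = rec_nat (N 0) (\<lambda>k rk. max (Suc rk) (N (Suc k)))"
    have r: "r k \<ge> N k" for k by (cases k) (auto simp: r_def)
    have "strict_mono r" by (rule strict_monoI_Suc) (simp add: r_def)
    with r N show ?thesis by (meson order_trans)
  qed
  then obtain r where r: "strict_mono r" and
    Xr: "\<And>k m. m \<ge> r k \<Longrightarrow> norm (X m - X (r k)) < (1/2)^k" by blast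
  have "\<exists>u. \<forall>k. square_integrable (u k) \<and> X k = abs_L2 (u k)"
    by (intro choice allI) (meson L2_exhaust)
  then obtain u where u: "\<And>k. square_integrable (u k)" "\<And>k. X k = abs_L2 (u k)" by blast
  have [measurable]: "u k \<in> borel_measurable M01" for k using u by (auto simp: square_integrable_def)
  define d where "d k = (\<lambda>x. u (r (Suc k)) x - u (r k) x)" for k
  have [measurable]: "d k \<in> borel_measurable M01" for k by (simp add: d_def)
  have "(\<integral>\<^sup>+x. ennreal (norm (d k x)) \<partial>M01) \<le> ennreal ((1/2)^k)" for k
  proof (rule nn_integral_norm_le)
    have "r k \<le> r (Suc k)" using r by (simp add: strict_mono_less_eq)
    then show "norm (abs_L2 (d k)) \<le> (1/2)^k"
      using Xr[of k "r (Suc k)"] by (simp add: d_def abs_L2_diff u)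
  qed (auto simp: d_def u intro: square_integrable_diff)
  then have "(\<Sum>k. \<integral>\<^sup>+x. ennreal (norm (d k x)) \<partial>M01) \<le> (\<Sum>k. ennreal ((1/2)^k))"
    by (intro suminf_le) auto
  also have "\<dots> = ennreal (\<Sum>k. (1/2)^k)"
    by (rule suminf_ennreal2) (auto intro: summable_geometric)
  also have "\<dots> < \<infinity>" by simp
  finally have "(\<integral>\<^sup>+x. (\<Sum>k. ennreal (norm (d k x))) \<partial>M01) \<noteq> \<infinity>"
    by (subst nn_integral_suminf) auto
  then have fin: "AE x in M01. (\<Sum>k. ennreal (norm (d k x))) \<noteq> \<infinity>"
    by (intro nn_integral_PInf_AE) auto
  have conv: "AE x in M01. convergent (\<lambda>k. u (r k) x)"
    using fin
  proof eventually_elim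
    case (elim x)
    have "summable (\<lambda>k. norm (d k x))"
      by (rule summable_suminf_not_top) (use elim in auto)
    then have "summable (\<lambda>k. d k x)" by (rule summable_norm_cancel)
    then have "convergent (\<lambda>n. \<Sum>k<n. d k x)" by (simp add: summable_iff_convergent)
    then have "convergent (\<lambda>n. u (r n) x - u (r 0) x)"
      by (simp add: d_def sum_lessThan_telescope[where f = "\<lambda>k. u (r k) x"])
    then show ?case by (simp add: convergent_diff_const_right_iff)
  qed
  define v where "v x = lim (\<lambda>k. u (r k) x)" for x
  have [measurable]: "v \<in> borel_measurable M01" unfolding v_def by measurable
  have v: "AE x in M01. (\<lambda>k. u (r k) x) \<longlonglongrightarrow> v x"
    using conv by eventually_elim (simp add: v_def convergent_LIMSEQ_iff)
  have est: "(\<integral>\<^sup>+x. ennreal ((norm (u (r k) x - v x))\<^sup>2) \<partial>M01) \<le> ennreal (((1/2)^k)\<^sup>2)" for k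
  proof -
    have "(\<integral>\<^sup>+x. ennreal ((norm (u (r k) x - v x))\<^sup>2) \<partial>M01)
        = (\<integral>\<^sup>+x. liminf (\<lambda>m. ennreal ((norm (u (r k) x - u (r m) x))\<^sup>2)) \<partial>M01)"
    proof (rule nn_integral_cong_AE)
      show "AE x in M01. ennreal ((norm (u (r k) x - v x))\<^sup>2)
          = liminf (\<lambda>m. ennreal ((norm (u (r k) x - u (r m) x))\<^sup>2))"
        using v
      proof eventually_elim
        case (elim x)
        then have "(\<lambda>m. ennreal ((norm (u (r k) x - u (r m) x))\<^sup>2))
            \<longlonglongrightarrow> ennreal ((norm (u (r k) x - v x))\<^sup>2)"
          by (intro tendsto_intros tendsto_ennrealI)
        then show ?case by (rule lim_imp_Liminf[OF sequentially_bot, symmetric])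
      qed
    qed
    also have "\<dots> \<le> liminf (\<lambda>m. \<integral>\<^sup>+x. ennreal ((norm (u (r k) x - u (r m) x))\<^sup>2) \<partial>M01)"
      by (rule nn_integral_liminf) measurable
    also have "\<dots> \<le> ennreal (((1/2)^k)\<^sup>2)"
    proof (rule Liminf_le)
      show "\<forall>\<^sub>F m in sequentially. (\<integral>\<^sup>+x. ennreal ((norm (u (r k) x - u (r m) x))\<^sup>2) \<partial>M01)
          \<le> ennreal (((1/2)^k)\<^sup>2)"
      proof (rule eventually_sequentiallyI[of k])
        fix m assume "k \<le> m"
        then have "norm (X (r m) - X (r k)) \<le> (1/2)^k"
          using r Xr[of k "r m"] by (simp add: strict_mono_less_eq less_imp_le)
        then have "(norm (X (r k) - X (r m)))\<^sup>2 \<le> ((1/2)^k)\<^sup>2"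
          by (intro power_mono) (auto simp: norm_minus_commute)
        then show "(\<integral>\<^sup>+x. ennreal ((norm (u (r k) x - u (r m) x))\<^sup>2) \<partial>M01) \<le> ennreal (((1/2)^k)\<^sup>2)"
          using nn_integral_norm_sq[OF square_integrable_diff[OF u(1) u(1)]]
          by (simp add: u abs_L2_diff)
      qed
    qed simp
    finally show ?thesis .
  qed
  have sd: "square_integrable (\<lambda>x. u (r k) x - v x)" for k
  proof -
    have "integrable M01 (\<lambda>x. (norm (u (r k) x - v x))\<^sup>2)"
      by (rule integrableI_bounded) (use le_less_trans[OF est] in auto)
    then show ?thesis by (simp add: square_integrable_def)
  qed
  have sv: "square_integrable v"
    using square_integrable_diff[OF u(1) sd[of 0], of "r 0"] by simp
  have "norm (X (r k) - abs_L2 v) \<le> (1/2)^k" for k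
  proof -
    have "(norm (X (r k) - abs_L2 v))\<^sup>2 \<le> ((1/2)^k)\<^sup>2"
      using est[of k] nn_integral_norm_sq[OF sd[of k]] by (simp add: u abs_L2_diff sv)
    then show ?thesis by (rule power2_le_imp_le) simp
  qed
  then have "(\<lambda>k. X (r k) - abs_L2 v) \<longlonglongrightarrow> 0"
    by (intro Lim_null_comparison[OF always_eventually LIMSEQ_power_zero[of "1/2 :: real"]])
      auto
  then have "(X \<circ> r) \<longlonglongrightarrow> abs_L2 v" by (simp add: LIM_zero_iff o_def)
  then have "X \<longlonglongrightarrow> abs_L2 v"
    by (rule Cauchy_converges_subseq[OF C r])
  then show "convergent X" by (auto simp: convergent_def)
qed

instance L2 :: banach ..

section \<open>Density of sine polynomials\<close>

lemma measurable_M01_continuous: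
  fixes u :: "real \<Rightarrow> 'a :: {second_countable_topology, topological_space}"
  assumes "continuous_on UNIV u"
  shows "u \<in> borel_measurable M01"
  using borel_measurable_continuous_onI[OF assms]
  by (intro measurable_restrict_space1 measurable_completion) simp

lemma square_integrable_continuous:
  fixes u :: "real \<Rightarrow> complex"
  assumes "continuous_on UNIV u"
  shows "square_integrable u"
proof -
  have "compact (u ` {0..1})"
    by (rule compact_continuous_image) (auto intro: continuous_on_subset[OF assms])
  then have "bounded (u ` {0..1})" by (rule compact_imp_bounded)
  then obtain B where "\<forall>z\<in>u ` {0..1}. norm z \<le> B"
    unfolding bounded_iff by blast
  then show ?thesis
    by (intro square_integrable_bounded[of _ B] measurable_M01_continuous assms) auto
qed

lemma norm_abs_L2_le:
  assumes "square_integrable u" "\<And>x. x \<in> {0<..<1} \<Longrightarrow> norm (u x) \<le> B" "B \<ge> 0"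
  shows "norm (abs_L2 u) \<le> B"
proof -
  interpret finite_measure M01 by (rule finite_measure_M01)
  have "(norm (abs_L2 u))\<^sup>2 \<le> (\<integral>x. B\<^sup>2 \<partial>M01)"
    unfolding norm_abs_L2[OF assms(1)] using assms
    by (intro integral_mono) (auto simp: square_integrable_def intro: power_mono)
  also have "\<dots> = B\<^sup>2" by (simp add: measure_restrict_space)
  finally show ?thesis using assms(3) by (simp add: power2_le_iff_abs_le)
qed

definition sine_mode :: "nat \<Rightarrow> L2" where
  "sine_mode n = abs_L2 (dilations sine n)"

lemma continuous_dilations_sine: "continuous_on S (dilations sine n)"
  unfolding dilations_def sine_def by (intro continuous_intros)

lemma square_integrable_dilations_sine: "square_integrable (dilations sine n)"
  by (rule square_integrable_continuous[OF continuous_dilations_sine])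

lemma closure_add:
  fixes x y :: "'a :: real_normed_vector"
  assumes S: "\<And>x y. x \<in> S \<Longrightarrow> y \<in> S \<Longrightarrow> x + y \<in> S" and xy: "x \<in> closure S" "y \<in> closure S"
  shows "x + y \<in> closure S"
proof -
  obtain a b where "\<And>n::nat. a n \<in> S" "a \<longlonglongrightarrow> x" "\<And>n::nat. b n \<in> S" "b \<longlonglongrightarrow> y"
    using xy unfolding closure_sequential by blast
  then have "(\<forall>n. a n + b n \<in> S) \<and> (\<lambda>n. a n + b n) \<longlonglongrightarrow> x + y"
    using S by (auto intro: tendsto_add)
  then show ?thesis unfolding closure_sequential by (rule exI[of _ "\<lambda>n. a n + b n"])
qed

lemma closure_scaleC:
  assumes S: "\<And>x. x \<in> S \<Longrightarrow> scaleC c x \<in> S" and x: "x \<in> closure S"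
  shows "scaleC c x \<in> closure S"
proof -
  obtain a where "\<And>n::nat. a n \<in> S" "a \<longlonglongrightarrow> x"
    using x unfolding closure_sequential by blast
  then have "(\<forall>n. scaleC c (a n) \<in> S) \<and> (\<lambda>n. scaleC c (a n)) \<longlonglongrightarrow> scaleC c x"
    using S by (auto intro: bounded_linear.tendsto[OF bounded_linear_scaleC])
  then show ?thesis unfolding closure_sequential by (rule exI[of _ "\<lambda>n. scaleC c (a n)"])
qed

abbreviation sine_span :: "L2 set" where
  "sine_span \<equiv> L2.span (sine_mode ` {1..})"

lemma sine_mode_in_span: "n \<ge> 1 \<Longrightarrow> sine_mode n \<in> sine_span"
  by (auto intro: L2.span_base)

text \<open>
  Multiplication by \<open>cos (\<pi> x)\<close> preserves sine polynomials because
  \<open>2 sin (n y) cos y = sin ((n+1) y) + sin ((n-1) y)\<close>.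
\<close>
lemma sine_cos_power_in_span:
  assumes "n \<ge> 1"
  shows "abs_L2 (\<lambda>x. of_real (sin (pi * (real n * x)) * cos (pi * x) ^ k)) \<in> sine_span"
  using assms
proof (induction k arbitrary: n)
  case 0
  then show ?case
    using sine_mode_in_span[of n] by (simp add: sine_mode_def dilations_def sine_def[abs_def])
next
  case (Suc k)
  let ?u = "\<lambda>n x. of_real (sin (pi * (real n * x)) * cos (pi * x) ^ k) :: complex"
  have sq: "square_integrable (?u n)" for n
    by (intro square_integrable_continuous continuous_intros)
  \<comment> \<open>For \<open>n = 1\<close> the term with \<open>n - 1\<close> is zero, so the index 0 has to be admitted here.\<close>
  have mem: "abs_L2 (?u n) \<in> sine_span" for n
  proof (cases "n = 0")
    case True
    then show ?thesis by (simp add: abs_L2_zero L2.span_zero)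
  next
    case False
    then show ?thesis by (intro Suc.IH) simp
  qed
  have sc: "sin (pi * (real n * x)) * cos (pi * x)
      = (sin (pi * (real (n + 1) * x)) + sin (pi * (real (n - 1) * x))) / 2" for x
  proof -
    have "pi * (real (n + 1) * x) = pi * (real n * x) + pi * x"
      "pi * (real (n - 1) * x) = pi * (real n * x) - pi * x"
      using Suc.prems by (simp_all add: of_nat_diff algebra_simps)
    then show ?thesis by (simp add: sin_add sin_diff)
  qed
  have "sin (pi * (real n * x)) * cos (pi * x) ^ Suc k
      = (1/2) * (sin (pi * (real (n + 1) * x)) * cos (pi * x) ^ k
        + sin (pi * (real (n - 1) * x)) * cos (pi * x) ^ k)" for x
  proof -
    have "sin (pi * (real n * x)) * cos (pi * x) ^ Suc k
        = (sin (pi * (real n * x)) * cos (pi * x)) * cos (pi * x) ^ k" by simp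
    then show ?thesis unfolding sc by (simp only:) (simp add: distrib_right)
  qed
  then have "(\<lambda>x. of_real (sin (pi * (real n * x)) * cos (pi * x) ^ Suc k) :: complex)
      = (\<lambda>x. (1/2) * (?u (n + 1) x + ?u (n - 1) x))"
    by (simp only: of_real_add of_real_mult of_real_divide of_real_1 of_real_numeral)
  then have "abs_L2 (\<lambda>x. of_real (sin (pi * (real n * x)) * cos (pi * x) ^ Suc k))
      = scaleC (1/2) (abs_L2 (?u (n + 1)) + abs_L2 (?u (n - 1)))"
    by (simp only: abs_L2_add[OF sq sq] abs_L2_scale[OF square_integrable_add[OF sq sq]])
  then show ?case
    using mem by (simp only: L2.span_scale L2.span_add)
qed

text \<open>
  On \<open>[0,1]\<close> a continuous function is a continuous function of \<open>cos (\<pi> x)\<close>, so the Weierstrass theorem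
  approximates it uniformly by polynomials in \<open>cos (\<pi> x)\<close>. The factor \<open>sin (\<pi> x)\<close> turns these into sine
  polynomials.
\<close>
lemma sine_times_continuous_real_in_closure:
  fixes g :: "real \<Rightarrow> real"
  assumes g: "continuous_on UNIV g"
  shows "abs_L2 (\<lambda>x. of_real (sin (pi * x) * g x)) \<in> closure sine_span"
  unfolding closure_approachable
proof (intro allI impI)
  fix e :: real assume e: "e > 0"
  have "continuous_on {-1..1} (\<lambda>y. g (arccos y / pi))"
    by (intro continuous_on_compose2[OF g] continuous_intros) auto
  then obtain q where q: "real_polynomial_function q"
      "\<And>y. y \<in> {-1..1} \<Longrightarrow> \<bar>g (arccos y / pi) - q y\<bar> < e / 2"
    using Stone_Weierstrass_real_polynomial_function[of "{-1..1}" "\<lambda>y. g (arccos y / pi)" "e / 2"] e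
    by (metis compact_Icc half_gt_zero)
  obtain a N where qa: "q = (\<lambda>y. \<Sum>i\<le>N. a i * y ^ i)"
    using q(1) unfolding real_polynomial_function_iff_sum by blast
  define w :: "real \<Rightarrow> complex" where "w x = of_real (sin (pi * x) * q (cos (pi * x)))" for x
  let ?v = "\<lambda>i x. of_real (sin (pi * (real 1 * x)) * cos (pi * x) ^ i) :: complex"
  have sv: "square_integrable (?v i)" for i
    by (intro square_integrable_continuous continuous_intros)
  have w: "w = (\<lambda>x. \<Sum>i\<le>N. of_real (a i) * ?v i x)"
    by (simp add: w_def fun_eq_iff qa sum_distrib_left mult_ac)
  have sw: "square_integrable w"
    unfolding w by (intro square_integrable_sum square_integrable_scale sv)
  have su: "square_integrable (\<lambda>x. of_real (sin (pi * x) * g x))"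
    by (intro square_integrable_continuous continuous_intros g)
  have "abs_L2 w = (\<Sum>i\<le>N. scaleC (of_real (a i)) (abs_L2 (?v i)))"
    unfolding w by (simp only: abs_L2_sum[OF square_integrable_scale[OF sv]] abs_L2_scale[OF sv])
  also have "\<dots> \<in> sine_span"
    by (intro L2.span_sum L2.span_scale sine_cos_power_in_span) simp
  finally have "abs_L2 w \<in> sine_span" .
  moreover have "dist (abs_L2 w) (abs_L2 (\<lambda>x. of_real (sin (pi * x) * g x))) < e"
  proof -
    have "norm (abs_L2 (\<lambda>x. w x - of_real (sin (pi * x) * g x))) \<le> e / 2"
    proof (rule norm_abs_L2_le[OF square_integrable_diff[OF sw su]])
      fix x :: real assume x: "x \<in> {0<..<1}"
      have "arccos (cos (pi * x)) = pi * x" using x by (intro arccos_cos) auto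
      then have "\<bar>q (cos (pi * x)) - g x\<bar> < e / 2"
        using q(2)[of "cos (pi * x)"] by (simp add: abs_minus_commute)
      then have "\<bar>sin (pi * x)\<bar> * \<bar>q (cos (pi * x)) - g x\<bar> \<le> 1 * (e / 2)"
        by (intro mult_mono) auto
      then show "norm (w x - of_real (sin (pi * x) * g x)) \<le> e / 2"
        unfolding w_def of_real_diff[symmetric] norm_of_real
        by (simp add: abs_mult flip: right_diff_distrib)
    qed (use e in auto)
    then show ?thesis
      unfolding dist_norm abs_L2_diff[OF sw su, symmetric] using e by linarith
  qed
  ultimately show "\<exists>y\<in>sine_span. dist y (abs_L2 (\<lambda>x. of_real (sin (pi * x) * g x))) < e" by blast
qed

lemma sine_times_continuous_in_closure:
  fixes g :: "real \<Rightarrow> complex"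
  assumes g: "continuous_on UNIV g"
  shows "abs_L2 (\<lambda>x. of_real (sin (pi * x)) * g x) \<in> closure sine_span"
proof -
  let ?R = "\<lambda>x. of_real (sin (pi * x) * Re (g x)) :: complex"
  let ?I = "\<lambda>x. of_real (sin (pi * x) * Im (g x)) :: complex"
  have sq: "square_integrable ?R" "square_integrable ?I"
    by (intro square_integrable_continuous continuous_intros g)+
  have "(\<lambda>x. of_real (sin (pi * x)) * g x) = (\<lambda>x. ?R x + \<i> * ?I x)"
    by (simp add: fun_eq_iff complex_eq_iff)
  then have "abs_L2 (\<lambda>x. of_real (sin (pi * x)) * g x) = abs_L2 ?R + scaleC \<i> (abs_L2 ?I)"
    by (simp only: abs_L2_add[OF sq(1) square_integrable_scale[OF sq(2)]] abs_L2_scale[OF sq(2)])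
  also have "\<dots> \<in> closure sine_span"
    by (intro closure_add closure_scaleC L2.span_add L2.span_scale
        sine_times_continuous_real_in_closure continuous_intros g)
  finally show ?thesis .
qed

text \<open>
  A measurable function is an almost everywhere limit of continuous ones. Radial truncation keeps these
  continuous and makes them uniformly bounded, so that dominated convergence applies.
\<close>
lemma sine_times_bounded_in_closure:
  assumes v: "v \<in> borel_measurable M01" "\<And>x. norm (v x) \<le> B"
  shows "abs_L2 (\<lambda>x. of_real (sin (pi * x)) * v x) \<in> closure sine_span"
proof -
  have "v measurable_on {0<..<1}"
    using v(1) by (simp add: measurable_on_iff_borel_measurable)
  then obtain N g where N: "negligible N" and g: "\<And>n::nat. continuous_on UNIV (g n)"
      "\<And>x. x \<notin> N \<Longrightarrow> (\<lambda>n. g n x) \<longlonglongrightarrow> (if x \<in> {0<..<1} then v x else 0)"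
    unfolding measurable_on_def by blast
  \<comment> \<open>The truncation divides by \<open>C\<close>, so the bound is enlarged to be positive.\<close>
  define C where "C = \<bar>B\<bar> + 1"
  have C: "C > 0" "norm (v x) \<le> C" for x using v(2)[of x] by (auto simp: C_def)
  define h where "h n x = g n x / of_real (max 1 (norm (g n x) / C))" for n x
  have hC: "norm (h n x) \<le> C" for n x
  proof -
    have "norm (g n x) \<le> C * max 1 (norm (g n x) / C)"
      using C(1) by (simp add: max_def field_simps)
    moreover have "norm (h n x) = norm (g n x) / max 1 (norm (g n x) / C)"
      by (simp add: h_def norm_divide)
    moreover have "max 1 (norm (g n x) / C) > 0" by linarith
    ultimately show ?thesis by (simp only: pos_divide_le_eq)
  qed
  have max_nz: "complex_of_real (max 1 t) \<noteq> 0" for t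
    unfolding of_real_eq_0_iff by linarith
  have hc: "continuous_on UNIV (h n)" for n
    unfolding h_def by (intro continuous_intros g ballI max_nz) (use C(1) in simp)
  have sc: "square_integrable (\<lambda>x. of_real (sin (pi * x)) * h n x)" for n
    by (intro square_integrable_continuous continuous_intros hc)
  have "(\<lambda>n. abs_L2 (\<lambda>x. of_real (sin (pi * x)) * h n x)) \<longlonglongrightarrow>
      abs_L2 (\<lambda>x. of_real (sin (pi * x)) * v x)"
  proof (rule abs_L2_tendsto_dominated(2)[OF sc])
    show "(\<lambda>x. of_real (sin (pi * x)) * v x) \<in> borel_measurable M01"
      by (intro borel_measurable_times v measurable_M01_continuous continuous_intros)
    show "square_integrable (\<lambda>x. of_real C)"
      by (intro square_integrable_continuous continuous_intros)
    have "AE x in lebesgue. x \<notin> N"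
      using N by (simp add: negligible_iff_null_sets AE_not_in)
    then have "AE x in M01. x \<notin> N"
      by (simp add: AE_restrict_space_iff) (auto elim: eventually_mono)
    moreover have "AE x in M01. x \<in> {0<..<1}" by (rule AE_I2) simp
    ultimately show "AE x in M01. (\<lambda>n. of_real (sin (pi * x)) * h n x) \<longlonglongrightarrow> of_real (sin (pi * x)) * v x"
    proof eventually_elim
      case (elim x)
      then have gv: "(\<lambda>n. g n x) \<longlonglongrightarrow> v x" using g(2)[of x] by simp
      have "norm (v x) / C \<le> 1" using C by (simp add: divide_le_eq)
      then have "max 1 (norm (v x) / C) = 1" by (rule max_absorb1)
      moreover have "(\<lambda>n. h n x) \<longlonglongrightarrow> v x / of_real (max 1 (norm (v x) / C))"
        unfolding h_def by (intro tendsto_intros gv max_nz) (use C(1) in simp)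
      ultimately show ?case by (intro tendsto_intros) simp
    qed
    show "AE x in M01. norm (of_real (sin (pi * x)) * h n x) \<le> norm (of_real C :: complex)" for n
    proof (rule AE_I2)
      fix x
      have "\<bar>sin (pi * x)\<bar> * norm (h n x) \<le> 1 * C" using hC by (intro mult_mono) auto
      then show "norm (of_real (sin (pi * x)) * h n x) \<le> norm (of_real C :: complex)"
        using C by (simp add: norm_mult)
    qed
  qed
  then show ?thesis
    by (rule closed_sequentially[OF closed_closure, rotated])
      (intro sine_times_continuous_in_closure hc)
qed

text \<open>
  Every square integrable \<open>u\<close> is the limit of its truncations to the sets where \<open>\<bar>u\<bar> \<le> n\<close> and
  \<open>sin (\<pi> x) \<ge> 1/n\<close>, and each truncation is \<open>sin (\<pi> x)\<close> times a bounded function.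
\<close>
lemma closure_sine_span: "closure sine_span = UNIV"
proof -
  have "X \<in> closure sine_span" for X
  proof -
    obtain u where u: "square_integrable u" "X = abs_L2 u" by (rule L2_exhaust)
    have [measurable]: "u \<in> borel_measurable M01" using u by (simp add: square_integrable_def)
    have s[measurable]: "(\<lambda>x. sin (pi * x)) \<in> borel_measurable M01"
      by (intro measurable_M01_continuous continuous_intros)
    define A where "A n = {x. real n * sin (pi * x) \<ge> 1 \<and> norm (u x) \<le> real n}" for n
    define v where "v n x = (if x \<in> A n then u x / of_real (sin (pi * x)) else 0)" for n x
    have sv: "of_real (sin (pi * x)) * v n x = (if x \<in> A n then u x else 0)" for n x
      by (auto simp: v_def A_def)
    have vm: "v n \<in> borel_measurable M01" for n
      unfolding v_def A_def mem_Collect_eq by measurable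
    have vb: "norm (v n x) \<le> real n * real n" for n x
    proof (cases "x \<in> A n")
      case True
      then have A: "real n * sin (pi * x) \<ge> 1" "norm (u x) \<le> real n" by (auto simp: A_def)
      then have s: "sin (pi * x) > 0" by (smt (verit) mult_nonneg_nonpos of_nat_0_le_iff)
      have "norm (u x) * 1 \<le> real n * (real n * sin (pi * x))" using A by (intro mult_mono) auto
      then show ?thesis using s True by (simp add: v_def norm_divide divide_le_eq mult_ac)
    qed (simp add: v_def)
    have mem: "abs_L2 (\<lambda>x. of_real (sin (pi * x)) * v n x) \<in> closure sine_span" for n
      by (rule sine_times_bounded_in_closure[OF vm vb])
    have sq: "square_integrable (\<lambda>x. of_real (sin (pi * x)) * v n x)" for n
    proof -
      have "norm (of_real (sin (pi * x)) * v n x) \<le> 1 * (real n * real n)" for x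
        unfolding norm_mult using vb by (intro mult_mono) auto
      then show ?thesis
        by (intro square_integrable_bounded borel_measurable_times vm measurable_M01_continuous
            continuous_intros) auto
    qed
    have "(\<lambda>n. abs_L2 (\<lambda>x. of_real (sin (pi * x)) * v n x)) \<longlonglongrightarrow> abs_L2 u"
    proof (rule abs_L2_tendsto_dominated(2)[OF sq _ u(1)])
      show "AE x in M01. (\<lambda>n. of_real (sin (pi * x)) * v n x) \<longlonglongrightarrow> u x"
      proof (rule AE_I2)
        fix x assume "x \<in> space M01"
        then have x: "0 < x" "x < 1" by auto
        have s: "sin (pi * x) > 0" using x by (intro sin_gt_zero) auto
        obtain m where m: "real m \<ge> 1 / sin (pi * x)" "real m \<ge> norm (u x)"
          by (meson max.bounded_iff real_arch_simple)
        have "x \<in> A n" if "n \<ge> m" for n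
        proof -
          have "real n \<ge> 1 / sin (pi * x)" "real n \<ge> norm (u x)"
            using m that by (auto intro: order_trans)
          then show ?thesis using s by (simp add: A_def field_simps)
        qed
        then have "\<forall>\<^sub>F n in sequentially. of_real (sin (pi * x)) * v n x = u x"
          by (intro eventually_sequentiallyI[of m]) (simp add: sv)
        then show "(\<lambda>n. of_real (sin (pi * x)) * v n x) \<longlonglongrightarrow> u x"
          by (rule tendsto_eventually)
      qed
    qed (auto simp: sv)
    then show ?thesis
      unfolding u(2) by (rule closed_sequentially[OF closed_closure mem])
  qed
  then show ?thesis by auto
qed

section \<open>Dilation operators\<close>

text \<open>
  Cutting off outside the unit interval makes a function on \<open>(0,1)\<close> defined, and Lebesgue measurable,
  on the whole line, where affine substitutions are available.
\<close>
definition unit_cut :: "(real \<Rightarrow> complex) \<Rightarrow> real \<Rightarrow> complex" where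
  "unit_cut u x = indicator {0<..<1} x *\<^sub>R u x"

text \<open>
  For \<open>k < j\<close> the odd 2-periodic extension of \<open>u\<close>, evaluated at \<open>j x\<close> with \<open>k < j x < k + 1\<close>, is \<open>u (j x - k)\<close> if
  \<open>k\<close> is even and \<open>- u (k + 1 - j x)\<close> if \<open>k\<close> is odd. This definition and the next two give the sign and the
  affine argument of this \<open>k\<close>-th branch.
\<close>
definition branch_sign :: "nat \<Rightarrow> real" where
  "branch_sign k = (if even k then 1 else - 1)"

definition branch_shift :: "nat \<Rightarrow> real" where
  "branch_shift k = (if even k then - real k else real k + 1)"

definition branch :: "nat \<Rightarrow> nat \<Rightarrow> real \<Rightarrow> real" where
  "branch j k x = branch_shift k + (branch_sign k * real j) * x"

text \<open>
  At most one summand is nonzero at each point. Writing the dilated extension as such a sum reduces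
  measurability and integration to affine substitutions on single branches.
\<close>
definition odd_dilate :: "nat \<Rightarrow> (real \<Rightarrow> complex) \<Rightarrow> real \<Rightarrow> complex" where
  "odd_dilate j u x = (\<Sum>k<j. branch_sign k *\<^sub>R unit_cut u (branch j k x))"

lemma branch_in_unit_iff:
  "branch j k x \<in> {0<..<1} \<longleftrightarrow> real k < real j * x \<and> real j * x < real k + 1"
proof (cases "even k")
  case True
  then have "branch j k x = real j * x - real k"
    by (simp add: branch_def branch_shift_def branch_sign_def)
  then show ?thesis by auto
next
  case False
  then have "branch j k x = real k + 1 - real j * x"
    by (simp add: branch_def branch_shift_def branch_sign_def)
  then show ?thesis by auto
qed

lemma branch_slope: "j \<ge> 1 \<Longrightarrow> branch_sign k * real j \<noteq> 0" "\<bar>branch_sign k * real j\<bar> = real j"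
  by (auto simp: branch_sign_def)

lemma branches_disjoint:
  assumes "branch j k x \<in> {0<..<1}" "branch j l x \<in> {0<..<1}"
  shows "k = l"
proof -
  have "real k < real l + 1" "real l < real k + 1"
    using assms unfolding branch_in_unit_iff by linarith+
  then show ?thesis by linarith
qed

lemma branch_in_unit_imp:
  assumes "branch j k x \<in> {0<..<1}" "k < j"
  shows "x \<in> {0<..<1}"
proof -
  have *: "real k < real j * x" "real j * x < real k + 1"
    using assms(1) unfolding branch_in_unit_iff by auto
  have "0 < real j * x" using *(1) by (smt (verit) of_nat_0_le_iff)
  moreover have "real j * x < real j * 1" using *(2) assms(2) by linarith
  ultimately show ?thesis using assms(2)
    by (auto simp: zero_less_mult_iff dest: mult_left_less_imp_less)
qed

lemma odd_dilate_eq: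
  assumes "branch j k x \<in> {0<..<1}" "k < j"
  shows "odd_dilate j u x = branch_sign k *\<^sub>R u (branch j k x)"
proof -
  have "branch_sign l *\<^sub>R unit_cut u (branch j l x)
      = (if l = k then branch_sign k *\<^sub>R u (branch j k x) else 0)" for l
  proof (cases "l = k")
    case False
    then have "branch j l x \<notin> {0<..<1}" using branches_disjoint assms by blast
    then show ?thesis using False by (simp add: unit_cut_def)
  qed (use assms in \<open>simp add: unit_cut_def\<close>)
  then show ?thesis
    using assms by (simp add: odd_dilate_def)
qed

lemma norm_odd_dilate_sq:
  "(norm (odd_dilate j u x))\<^sup>2 = (\<Sum>k<j. (norm (unit_cut u (branch j k x)))\<^sup>2)"
proof (cases "\<exists>k<j. branch j k x \<in> {0<..<1}")
  case True
  then obtain k where k: "k < j" "branch j k x \<in> {0<..<1}" by blast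
  have "(norm (unit_cut u (branch j l x)))\<^sup>2
      = (if l = k then (norm (u (branch j k x)))\<^sup>2 else 0)" for l
  proof (cases "l = k")
    case False
    then have "branch j l x \<notin> {0<..<1}" using branches_disjoint k by blast
    then show ?thesis using False by (simp add: unit_cut_def)
  qed (use k in \<open>simp add: unit_cut_def\<close>)
  moreover have "\<bar>branch_sign k\<bar> = 1" by (simp add: branch_sign_def)
  ultimately show ?thesis
    using k by (simp add: odd_dilate_eq[OF k(2,1)])
next
  case False
  then have "unit_cut u (branch j k x) = 0" if "k < j" for k
    using that by (auto simp: unit_cut_def indicator_def)
  then show ?thesis by (simp add: odd_dilate_def)
qed

lemma measurable_unit_cut:
  assumes "u \<in> borel_measurable M01"
  shows "unit_cut u \<in> borel_measurable lebesgue"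
  using assms by (simp add: unit_cut_def[abs_def] borel_measurable_restrict_space_iff)

lemma measurable_unit_cut_affine:
  assumes "u \<in> borel_measurable M01" "c \<noteq> 0"
  shows "(\<lambda>x. unit_cut u (t + c * x)) \<in> borel_measurable lebesgue"
proof -
  have "(\<lambda>x. t + c * x) \<in> lebesgue \<rightarrow>\<^sub>M lebesgue"
    using lebesgue_affine_measurable[where c = "\<lambda>x::real. c" and t = t] assms(2) by simp
  from measurable_compose[OF this measurable_unit_cut[OF assms(1)]] show ?thesis .
qed

lemma integral_unit_cut:
  assumes "square_integrable u"
  shows "has_bochner_integral lebesgue (\<lambda>x. (norm (unit_cut u x))\<^sup>2) ((norm (abs_L2 u))\<^sup>2)"
proof -
  have eq: "(norm (unit_cut u x))\<^sup>2 = indicator {0<..<1} x *\<^sub>R (norm (u x))\<^sup>2" for x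
    by (simp add: unit_cut_def indicator_def)
  show ?thesis
    using assms unfolding has_bochner_integral_iff eq
    by (simp add: norm_abs_L2 square_integrable_def integrable_restrict_space integral_restrict_space)
qed

text \<open>
  Each of the \<open>j\<close> branches is a copy of \<open>u\<close> compressed by the factor \<open>j\<close> and contributes
  \<open>\<parallel>u\<parallel>\<^sup>2 / j\<close>.
\<close>
lemma integral_odd_dilate:
  assumes "square_integrable u" "j \<ge> 1"
  shows "has_bochner_integral lebesgue (\<lambda>x. (norm (odd_dilate j u x))\<^sup>2) ((norm (abs_L2 u))\<^sup>2)"
proof -
  have "has_bochner_integral lebesgue (\<lambda>x. (norm (unit_cut u (branch j k x)))\<^sup>2)
      ((norm (abs_L2 u))\<^sup>2 / real j)" for k
  proof -
    have "has_bochner_integral lebesgue (\<lambda>x. (norm (unit_cut u (branch j k x)))\<^sup>2)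
        ((norm (abs_L2 u))\<^sup>2 /\<^sub>R \<bar>branch_sign k * real j\<bar>)"
      unfolding branch_def
      by (rule iffD1[OF has_bochner_integral_lebesgue_real_affine_iff[OF branch_slope(1)[OF assms(2)]]
            integral_unit_cut[OF assms(1)]])
    then show ?thesis
      unfolding branch_slope(2) by (simp add: divide_inverse mult.commute)
  qed
  then have "has_bochner_integral lebesgue (\<lambda>x. \<Sum>k<j. (norm (unit_cut u (branch j k x)))\<^sup>2)
      (\<Sum>k<j. (norm (abs_L2 u))\<^sup>2 / real j)"
    by (intro has_bochner_integral_sum)
  then show ?thesis
    using assms(2) by (simp add: norm_odd_dilate_sq)
qed

lemma measurable_odd_dilate:
  assumes "u \<in> borel_measurable M01" "j \<ge> 1"
  shows "odd_dilate j u \<in> borel_measurable lebesgue"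
  unfolding odd_dilate_def[abs_def] branch_def using assms
  by (intro borel_measurable_sum borel_measurable_scaleR borel_measurable_const
      measurable_unit_cut_affine branch_slope(1))

lemma odd_dilate_outside:
  assumes "x \<notin> {0<..<1}"
  shows "odd_dilate j u x = 0"
  unfolding odd_dilate_def
proof (rule sum.neutral, rule ballI)
  fix k assume "k \<in> {..<j}"
  then have "branch j k x \<notin> {0<..<1}" using branch_in_unit_imp assms by blast
  then show "branch_sign k *\<^sub>R unit_cut u (branch j k x) = 0"
    by (simp add: unit_cut_def)
qed

lemma
  assumes "square_integrable u" "j \<ge> 1"
  shows square_integrable_odd_dilate: "square_integrable (odd_dilate j u)"
    and norm_odd_dilate: "norm (abs_L2 (odd_dilate j u)) = norm (abs_L2 u)"
proof -
  have eq: "indicator {0<..<1} x * (norm (odd_dilate j u x))\<^sup>2 = (norm (odd_dilate j u x))\<^sup>2" for x :: real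
    using odd_dilate_outside[of x j u] by (cases "x \<in> {0<..<1}") auto
  have I: "has_bochner_integral M01 (\<lambda>x. (norm (odd_dilate j u x))\<^sup>2) ((norm (abs_L2 u))\<^sup>2)"
    using integral_odd_dilate[OF assms] unfolding has_bochner_integral_iff
    by (simp add: integrable_restrict_space integral_restrict_space eq)
  moreover have "odd_dilate j u \<in> borel_measurable M01"
    using assms by (intro measurable_restrict_space1[OF measurable_odd_dilate])
      (auto simp: square_integrable_def)
  ultimately show s: "square_integrable (odd_dilate j u)"
    by (simp add: square_integrable_def has_bochner_integral_iff)
  show "norm (abs_L2 (odd_dilate j u)) = norm (abs_L2 u)"
    using norm_abs_L2[OF s] I by (simp add: has_bochner_integral_iff power2_eq_iff_nonneg)
qed

lemma odd_dilate_add: "odd_dilate j (\<lambda>x. u x + v x) = (\<lambda>x. odd_dilate j u x + odd_dilate j v x)"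
  by (simp add: odd_dilate_def fun_eq_iff unit_cut_def scaleR_add_right sum.distrib)

lemma odd_dilate_scale: "odd_dilate j (\<lambda>x. c * u x) = (\<lambda>x. c * odd_dilate j u x)"
  by (simp add: odd_dilate_def fun_eq_iff unit_cut_def sum_distrib_left)

lemma odd_dilate_diff: "odd_dilate j (\<lambda>x. u x - v x) = (\<lambda>x. odd_dilate j u x - odd_dilate j v x)"
  by (simp add: odd_dilate_def fun_eq_iff unit_cut_def scaleR_diff_right sum_subtractf)


text \<open>
  Any representative gives the same class for \<open>j \<ge> 1\<close>, because \<open>odd_dilate\<close> is linear and isometric;
  see \<open>dilation_abs_L2\<close>.
\<close>
definition dilation :: "nat \<Rightarrow> L2 \<Rightarrow> L2" where
  "dilation j X = abs_L2 (odd_dilate j (SOME u. square_integrable u \<and> X = abs_L2 u))"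

lemma dilation_abs_L2:
  assumes u: "square_integrable u" and j: "j \<ge> 1"
  shows "dilation j (abs_L2 u) = abs_L2 (odd_dilate j u)"
proof -
  define v where "v = (SOME v. square_integrable v \<and> abs_L2 u = abs_L2 v)"
  have v: "square_integrable v" "abs_L2 v = abs_L2 u"
    using someI[of "\<lambda>v. square_integrable v \<and> abs_L2 u = abs_L2 v" u] u by (auto simp: v_def)
  have "abs_L2 (odd_dilate j v) - abs_L2 (odd_dilate j u) = abs_L2 (odd_dilate j (\<lambda>x. v x - u x))"
    using u v j by (simp add: odd_dilate_diff abs_L2_diff square_integrable_odd_dilate)
  moreover have "norm (abs_L2 (odd_dilate j (\<lambda>x. v x - u x))) = 0"
    using u v j by (simp add: norm_odd_dilate square_integrable_diff abs_L2_diff)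
  ultimately show ?thesis by (simp add: dilation_def v_def)
qed

lemma norm_dilation: "j \<ge> 1 \<Longrightarrow> norm (dilation j X) = norm X"
  by (rule L2_exhaust[of X]) (simp add: dilation_abs_L2 norm_odd_dilate)

lemma dilation_add: "j \<ge> 1 \<Longrightarrow> dilation j (X + Y) = dilation j X + dilation j Y"
  by (rule L2_exhaust[of X], rule L2_exhaust[of Y])
    (simp add: dilation_abs_L2 square_integrable_odd_dilate square_integrable_add odd_dilate_add
      flip: abs_L2_add)

lemma dilation_scaleC: "j \<ge> 1 \<Longrightarrow> dilation j (scaleC c X) = scaleC c (dilation j X)"
  by (rule L2_exhaust[of X])
    (simp add: dilation_abs_L2 square_integrable_odd_dilate square_integrable_scale odd_dilate_scale
      flip: abs_L2_scale)

lemma bounded_linear_dilation: "j \<ge> 1 \<Longrightarrow> bounded_linear (dilation j)"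
  by (rule bounded_linear_intro[where K = 1])
    (auto simp: dilation_add dilation_scaleC scaleR_eq_scaleC norm_dilation)

lemma AE_lebesgue_affine:
  assumes "AE x in lebesgue. P x" "c \<noteq> (0::real)"
  shows "AE x in lebesgue. P (t + c * x)"
proof -
  have "{x. \<not> P x} \<in> null_sets lebesgue"
    using assms(1) by (simp add: completion.AE_iff_null_sets)
  then have "UNIV - {x. \<not> P x} \<in> sets lebesgue" by (intro sets.Diff) auto
  then have P: "{x. P x} \<in> sets lebesgue" by (simp add: Diff_eq Collect_neg_eq)
  have "(\<lambda>x. - t / c + 1 / c * x) \<in> lebesgue \<rightarrow>\<^sub>M lebesgue"
    using lebesgue_affine_measurable[where c = "\<lambda>x::real. 1 / c" and t = "- t / c"] assms(2) by simp
  then have m: "(\<lambda>x. - t / c + 1 / c * x) \<in> lebesgue \<rightarrow>\<^sub>M lebesgue" .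
  have "(\<lambda>x. t + c * x) \<in> lebesgue \<rightarrow>\<^sub>M lebesgue"
    using lebesgue_affine_measurable[where c = "\<lambda>x::real. c" and t = t] assms(2) by simp
  from measurable_sets[OF this P] have Q: "{x \<in> space lebesgue. P (t + c * x)} \<in> sets lebesgue"
    by (simp add: vimage_def)
  have "AE x in distr lebesgue lebesgue (\<lambda>x. - t / c + 1 / c * x). P (t + c * x)"
    unfolding AE_distr_iff[OF m Q] using assms by (simp add: right_diff_distrib)
  then have "AE x in density (distr lebesgue lebesgue (\<lambda>x. - t / c + 1 / c * x))
      (\<lambda>_. ennreal \<bar>1 / c\<bar>). P (t + c * x)"
    by (simp add: AE_density)
  moreover have "lebesgue = density (distr lebesgue lebesgue (\<lambda>x. - t / c + 1 / c * x))
      (\<lambda>_. ennreal \<bar>1 / c\<bar>)"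
    using assms(2) by (intro lebesgue_real_affine) simp
  ultimately show ?thesis by (simp only:)
qed

lemma periodic_2_shift:
  fixes g :: "real \<Rightarrow> 'a"
  assumes "\<And>x. g (x + 2) = g x"
  shows "g (x - 2 * real m) = g x"
proof (induction m)
  case (Suc m)
  then show ?case using assms[of "x - 2 * real (Suc m)"] by (simp add: algebra_simps)
qed simp

text \<open>
  Periodicity and oddness reduce \<open>g (j x)\<close> to the value of \<open>g\<close> at the branch argument in \<open>(0,1)\<close>. The
  exceptional points are the preimages under the branches of the null set where oddness fails, and the
  finitely many endpoints \<open>k / j\<close>.
\<close>
lemma
  fixes g :: "real \<Rightarrow> complex"
  assumes periodic: "\<And>x. g (x + 2) = g x"
    and odd: "AE x in lebesgue. g (- x) = - g x"
    and g: "square_integrable g" and j: "j \<ge> 1"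
  shows square_integrable_dilations: "square_integrable (dilations g j)"
    and dilation_abs_L2_periodic: "dilation j (abs_L2 g) = abs_L2 (dilations g j)"
proof -
  have "AE x in lebesgue. \<forall>k<j. g (- branch j k x) = - g (branch j k x)"
  proof -
    have "AE x in lebesgue. \<forall>k\<in>{..<j}. g (- branch j k x) = - g (branch j k x)"
      unfolding branch_def
      by (intro AE_finite_allI finite_lessThan AE_lebesgue_affine[OF odd] branch_slope(1) j)
    then show ?thesis by eventually_elim auto
  qed
  moreover have "AE x in lebesgue. \<forall>k<j. x \<noteq> real k / real j"
  proof -
    have "negligible ((\<lambda>k. real k / real j) ` {..<j})" by (intro negligible_finite) auto
    then have "AE x in lebesgue. x \<notin> (\<lambda>k. real k / real j) ` {..<j}"
      by (simp add: negligible_iff_null_sets AE_not_in)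
    then show ?thesis by eventually_elim auto
  qed
  ultimately have "AE x in lebesgue. x \<in> {0<..<1} \<longrightarrow> odd_dilate j g x = dilations g j x"
  proof eventually_elim
    case (elim x)
    show ?case
    proof
      assume x: "x \<in> {0<..<1}"
      define k where "k = nat \<lfloor>real j * x\<rfloor>"
      have "0 \<le> real j * x" using x by simp
      then have k: "real k \<le> real j * x" "real j * x < real k + 1"
        by (auto simp: k_def of_nat_nat)
      have "real j * x < real j * 1" using x j by (intro mult_strict_left_mono) auto
      then have kj: "k < j" using k by linarith
      then have "x \<noteq> real k / real j" using elim(2) by blast
      then have "real k < real j * x" using k j by (auto simp: field_simps less_le)
      then have u: "branch j k x \<in> {0<..<1}" using k unfolding branch_in_unit_iff by simp
      have "odd_dilate j g x = branch_sign k *\<^sub>R g (branch j k x)"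
        by (rule odd_dilate_eq[OF u kj])
      also have "\<dots> = g (real j * x)"
      proof (cases "even k")
        case True
        then obtain m where m: "k = 2 * m" by (elim evenE)
        then show ?thesis using periodic_2_shift[of g, OF periodic, of "real j * x" m]
          by (simp add: branch_sign_def branch_def branch_shift_def algebra_simps)
      next
        case False
        then obtain m where m: "k = 2 * m + 1" by (elim oddE)
        have "- branch j k x = real j * x - 2 * real (m + 1)"
          using False by (simp add: branch_sign_def branch_def branch_shift_def m)
        then have "g (- branch j k x) = g (real j * x)"
          using periodic_2_shift[of g, OF periodic, of "real j * x" "m + 1"] by simp
        then show ?thesis using elim(1) kj False by (simp add: branch_sign_def)
      qed
      finally show "odd_dilate j g x = dilations g j x" by (simp add: dilations_def)
    qed
  qed
  note ae = this
  then have ae': "AE x in M01. odd_dilate j g x = dilations g j x"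
    by (simp add: AE_restrict_space_iff)
  have sq: "square_integrable (odd_dilate j g)" by (rule square_integrable_odd_dilate[OF g j])
  have "dilations g j \<in> borel_measurable M01"
  proof (rule borel_measurable_if_D)
    show "(\<lambda>x. if x \<in> {0<..<1} then dilations g j x else 0) \<in> borel_measurable lebesgue"
    proof (rule borel_measurable_AE)
      show "odd_dilate j g \<in> borel_measurable lebesgue"
        using g j by (intro measurable_odd_dilate) (auto simp: square_integrable_def)
      show "AE x in lebesgue. odd_dilate j g x = (if x \<in> {0<..<1} then dilations g j x else 0)"
        using ae by eventually_elim (auto simp: odd_dilate_outside)
    qed
  qed
  then show s: "square_integrable (dilations g j)"
    by (rule square_integrable_cong_AE[OF sq _ ae'])
  show "dilation j (abs_L2 g) = abs_L2 (dilations g j)"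
    unfolding dilation_abs_L2[OF g j] by (rule abs_L2_eqI[OF sq s ae'])
qed

section \<open>Orthogonality and mean values of Dirichlet polynomials\<close>

lemma integral_cos_unit:
  assumes "k \<noteq> (0::int)"
  shows "((\<lambda>x. cos (of_int k * pi * x)) has_integral 0) {0..1}"
proof -
  have "((\<lambda>x. cos (of_int k * pi * x)) has_integral
      sin (of_int k * pi * 1) / (of_int k * pi) - sin (of_int k * pi * 0) / (of_int k * pi)) {0..1}"
    by (rule fundamental_theorem_of_calculus)
      (use assms in \<open>auto intro!: derivative_eq_intros simp flip: has_real_derivative_iff_has_vector_derivative\<close>)
  moreover have "sin (of_int k * pi) = 0" using sin_npi_int[of k] by (simp add: mult.commute)
  ultimately show ?thesis by simp
qed

lemma integral_sin_sin:
  assumes "m \<ge> 1" "n \<ge> 1"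
  shows "(\<integral>x. sin (pi * (real m * x)) * sin (pi * (real n * x)) \<partial>M01) = (if m = n then 1 / 2 else 0)"
proof -
  let ?f = "\<lambda>x. sin (pi * (real m * x)) * sin (pi * (real n * x))"
  have f: "?f x = (cos (of_int (int m - int n) * pi * x) - cos (of_int (int m + int n) * pi * x)) / 2" for x
  proof -
    have "of_int (int m - int n) * pi * x = pi * (real m * x) - pi * (real n * x)"
      "of_int (int m + int n) * pi * x = pi * (real m * x) + pi * (real n * x)"
      by (simp_all add: algebra_simps)
    then show ?thesis by (simp add: cos_add cos_diff)
  qed
  have 1: "((\<lambda>x. cos (of_int (int m - int n) * pi * x)) has_integral (if m = n then 1 else 0)) {0..1}"
  proof (cases "m = n")
    case True
    then show ?thesis using has_integral_const_real[of "1::real" 0 1] by simp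
  next
    case False
    then show ?thesis using integral_cos_unit[of "int m - int n"] by simp
  qed
  have 2: "((\<lambda>x. cos (of_int (int m + int n) * pi * x)) has_integral 0) {0..1}"
    using assms by (intro integral_cos_unit) simp
  have "(?f has_integral ((if m = n then 1 else 0) - 0) / 2) {0..1}"
    unfolding f by (intro has_integral_divide has_integral_diff 1 2)
  then have I: "integral {0<..<1} ?f = (if m = n then 1 / 2 else 0)"
    by (simp add: integral_open_interval_real[symmetric] integral_unique)
  have "integrable M01 ?f"
  proof -
    interpret finite_measure M01 by (rule finite_measure_M01)
    have "\<bar>?f x\<bar> \<le> 1 * 1" for x
      unfolding abs_mult by (intro mult_mono) auto
    then show ?thesis
      by (intro integrable_const_bound[of _ 1] AE_I2 measurable_M01_continuous continuous_intros) auto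
  qed
  then show ?thesis
    using I by (simp add: lebesgue_integral_eq_integral)
qed

lemma inner_sine_mode:
  assumes "m \<ge> 1" "n \<ge> 1"
  shows "scaleC a (sine_mode m) \<bullet> scaleC b (sine_mode n) = (if m = n then (a \<bullet> b) / 2 else 0)"
proof -
  have "scaleC a (sine_mode m) \<bullet> scaleC b (sine_mode n)
      = (\<integral>x. (a * dilations sine m x) \<bullet> (b * dilations sine n x) \<partial>M01)"
    unfolding sine_mode_def
    by (simp add: inner_abs_L2 square_integrable_scale square_integrable_dilations_sine
        flip: abs_L2_scale)
  also have "(\<lambda>x. (a * dilations sine m x) \<bullet> (b * dilations sine n x))
      = (\<lambda>x. (a \<bullet> b) * (sin (pi * (real m * x)) * sin (pi * (real n * x))))"
    by (simp add: fun_eq_iff dilations_def sine_def inner_complex_def algebra_simps)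
  also have "(\<integral>x. (a \<bullet> b) * (sin (pi * (real m * x)) * sin (pi * (real n * x))) \<partial>M01)
      = (a \<bullet> b) * (if m = n then 1 / 2 else 0)"
    by (simp only: integral_mult_right_zero integral_sin_sin[OF assms])
  finally show ?thesis by simp
qed

lemma inner_eq_Re_mult_cnj: "a \<bullet> b = Re (a * cnj b)"
  by (simp add: inner_complex_def)

lemma mean_powers_tendsto_0:
  fixes z :: complex
  assumes "norm z = 1" "z \<noteq> 1"
  shows "(\<lambda>T. (\<Sum>t<T. z ^ t) / of_nat T) \<longlonglongrightarrow> 0"
proof (rule Lim_null_comparison)
  show "\<forall>\<^sub>F T in sequentially. norm ((\<Sum>t<T. z ^ t) / of_nat T) \<le> 2 / norm (z - 1) / real T"
  proof (rule always_eventually, rule allI)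
    fix T
    have "norm (z ^ T - 1) \<le> norm (z ^ T) + norm (1 :: complex)" by (rule norm_triangle_ineq4)
    then have "norm (z ^ T - 1) \<le> 2" using assms by (simp add: norm_power)
    then show "norm ((\<Sum>t<T. z ^ t) / of_nat T) \<le> 2 / norm (z - 1) / real T"
      using assms(2) by (simp add: geometric_sum norm_divide norm_mult divide_right_mono)
  qed
  show "(\<lambda>T. 2 / norm (z - 1) / real T) \<longlonglongrightarrow> 0"
    by (rule lim_const_over_n)
qed

text \<open>
  Orthogonality of the characters \<open>t \<mapsto> e\<^sup>i\<^sup>\<alpha>\<^sup>t\<close> of the integers. Frequencies that differ by less than \<open>2 \<pi>\<close>
  give different characters unless they are equal.
\<close>
lemma mean_characters:
  fixes \<alpha> \<beta> :: real and a b :: complex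
  assumes "\<bar>\<alpha> - \<beta>\<bar> < 2 * pi"
  shows "(\<lambda>T. (\<Sum>t<T. (a * cis (real t * \<alpha>)) \<bullet> (b * cis (real t * \<beta>))) / real T)
    \<longlonglongrightarrow> (if \<alpha> = \<beta> then a \<bullet> b else 0)"
proof -
  define z where "z = cis (\<alpha> - \<beta>)"
  have inner: "(a * cis (real t * \<alpha>)) \<bullet> (b * cis (real t * \<beta>)) = Re (a * cnj b * z ^ t)" for t
  proof -
    have "(a * cis (real t * \<alpha>)) \<bullet> (b * cis (real t * \<beta>))
        = Re (a * cnj b * (cis (real t * \<alpha>) * cnj (cis (real t * \<beta>))))"
      by (simp add: inner_eq_Re_mult_cnj mult_ac)
    also have "cis (real t * \<alpha>) * cnj (cis (real t * \<beta>)) = z ^ t"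
      unfolding z_def Complex.DeMoivre by (simp add: cis_cnj cis_mult right_diff_distrib)
    finally show ?thesis .
  qed
  show ?thesis
  proof (cases "\<alpha> = \<beta>")
    case True
    then have "z = 1" by (simp add: z_def)
    then have "\<forall>\<^sub>F T in sequentially.
        (\<Sum>t<T. (a * cis (real t * \<alpha>)) \<bullet> (b * cis (real t * \<beta>))) / real T = a \<bullet> b"
      unfolding inner by (intro eventually_sequentiallyI[of 1]) (simp add: inner_eq_Re_mult_cnj)
    then show ?thesis using True by (simp add: tendsto_eventually)
  next
    case False
    have "z \<noteq> 1"
    proof
      assume "z = 1"
      then have "cos (\<alpha> - \<beta>) = 1" by (metis z_def cis.sel(1) one_complex.sel(1))
      then obtain l :: int where l: "\<alpha> - \<beta> = of_int l * 2 * pi"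
        by (auto simp: cos_one_2pi_int)
      then have "\<bar>of_int l\<bar> * (2 * pi) < 1 * (2 * pi)" using assms by (simp add: abs_mult)
      then have "\<bar>of_int l :: real\<bar> < 1" by (rule mult_right_less_imp_less) simp
      then have "l = 0" by linarith
      with l False show False by simp
    qed
    then have "(\<lambda>T. (\<Sum>t<T. z ^ t) / of_nat T) \<longlonglongrightarrow> 0"
      by (intro mean_powers_tendsto_0) (simp_all add: z_def)
    then have "(\<lambda>T. Re (a * cnj b * ((\<Sum>t<T. z ^ t) / of_nat T))) \<longlonglongrightarrow> Re (a * cnj b * 0)"
      by (intro tendsto_intros)
    also have "(\<lambda>T. Re (a * cnj b * ((\<Sum>t<T. z ^ t) / of_nat T)))
        = (\<lambda>T. (\<Sum>t<T. (a * cis (real t * \<alpha>)) \<bullet> (b * cis (real t * \<beta>))) / real T)"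
    proof
      fix T
      have "Re (a * cnj b * ((\<Sum>t<T. z ^ t) / of_nat T))
          = Re ((\<Sum>t<T. a * cnj b * z ^ t) / of_real (real T))"
        by (simp add: sum_distrib_left)
      then show "Re (a * cnj b * ((\<Sum>t<T. z ^ t) / of_nat T))
          = (\<Sum>t<T. (a * cis (real t * \<alpha>)) \<bullet> (b * cis (real t * \<beta>))) / real T"
        unfolding inner Re_divide_of_real Re_sum .
    qed
    finally show ?thesis using False by simp
  qed
qed

text \<open>
  Parseval's identity for Dirichlet polynomials. The exponents \<open>t h ln n\<close> run over multiples of a step \<open>h\<close>
  so small that different \<open>n\<close> give different characters of the integers. The indices \<open>\<nu> i\<close> may repeat, so
  the identity applies to products of Dirichlet polynomials without collecting equal terms.
\<close>
lemma norm_sine_sum_mean: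
  fixes \<kappa> :: "'i \<Rightarrow> complex" and \<nu> :: "'i \<Rightarrow> nat"
  assumes "\<And>i. i \<in> I \<Longrightarrow> \<nu> i \<ge> 1"
    and "h > 0" "\<And>i. i \<in> I \<Longrightarrow> h * ln (real (\<nu> i)) < 2 * pi"
  shows "(\<lambda>T. (\<Sum>t<T. (norm (\<Sum>i\<in>I. \<kappa> i * cis (real t * (h * ln (real (\<nu> i))))))\<^sup>2) / real T)
    \<longlonglongrightarrow> 2 * (norm (\<Sum>i\<in>I. scaleC (\<kappa> i) (sine_mode (\<nu> i))))\<^sup>2"
proof -
  let ?\<theta> = "\<lambda>i. h * ln (real (\<nu> i))"
  let ?c = "\<lambda>i t. \<kappa> i * cis (real t * ?\<theta> i)"
  have lim: "(\<lambda>T. \<Sum>i\<in>I. \<Sum>j\<in>I. (\<Sum>t<T. ?c i t \<bullet> ?c j t) / real T)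
    \<longlonglongrightarrow> (\<Sum>i\<in>I. \<Sum>j\<in>I. if ?\<theta> i = ?\<theta> j then \<kappa> i \<bullet> \<kappa> j else 0)"
  proof (intro tendsto_sum mean_characters)
    fix i j assume ij: "i \<in> I" "j \<in> I"
    then have "?\<theta> i \<ge> 0" "?\<theta> j \<ge> 0" using assms by auto
    then show "\<bar>?\<theta> i - ?\<theta> j\<bar> < 2 * pi" using assms(3)[OF ij(1)] assms(3)[OF ij(2)] by linarith
  qed
  have "(\<Sum>i\<in>I. \<Sum>j\<in>I. (\<Sum>t<T. ?c i t \<bullet> ?c j t) / real T)
      = (\<Sum>t<T. (norm (\<Sum>i\<in>I. ?c i t))\<^sup>2) / real T" for T
  proof -
    have "(\<Sum>t<T. (norm (\<Sum>i\<in>I. ?c i t))\<^sup>2) = (\<Sum>t<T. \<Sum>i\<in>I. \<Sum>j\<in>I. ?c i t \<bullet> ?c j t)"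
      by (simp only: power2_norm_eq_inner inner_sum_left inner_sum_right inner_commute)
    also have "\<dots> = (\<Sum>i\<in>I. \<Sum>j\<in>I. \<Sum>t<T. ?c i t \<bullet> ?c j t)"
      by (subst sum.swap, intro sum.cong refl sum.swap)
    finally show ?thesis by (simp only: sum_divide_distrib)
  qed
  moreover have "(\<Sum>i\<in>I. \<Sum>j\<in>I. if ?\<theta> i = ?\<theta> j then \<kappa> i \<bullet> \<kappa> j else 0)
      = 2 * (norm (\<Sum>i\<in>I. scaleC (\<kappa> i) (sine_mode (\<nu> i))))\<^sup>2"
  proof -
    have "(norm (\<Sum>i\<in>I. scaleC (\<kappa> i) (sine_mode (\<nu> i))))\<^sup>2
        = (\<Sum>i\<in>I. \<Sum>j\<in>I. scaleC (\<kappa> i) (sine_mode (\<nu> i)) \<bullet> scaleC (\<kappa> j) (sine_mode (\<nu> j)))"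
      by (simp only: power2_norm_eq_inner inner_sum_left inner_sum_right inner_commute)
    also have "\<dots> = (\<Sum>i\<in>I. \<Sum>j\<in>I. (if ?\<theta> i = ?\<theta> j then \<kappa> i \<bullet> \<kappa> j else 0) / 2)"
    proof (intro sum.cong refl)
      fix i j assume "i \<in> I" "j \<in> I"
      then have "\<nu> i \<ge> 1" "\<nu> j \<ge> 1" using assms(1) by auto
      moreover from this have "?\<theta> i = ?\<theta> j \<longleftrightarrow> \<nu> i = \<nu> j"
        using assms(2) by simp
      ultimately show "scaleC (\<kappa> i) (sine_mode (\<nu> i)) \<bullet> scaleC (\<kappa> j) (sine_mode (\<nu> j))
          = (if ?\<theta> i = ?\<theta> j then \<kappa> i \<bullet> \<kappa> j else 0) / 2"
        by (simp only: inner_sine_mode) simp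
    qed
    finally show ?thesis by (simp add: sum_divide_distrib[symmetric])
  qed
  ultimately show ?thesis using lim by simp
qed

lemma dilation_sine_mode:
  assumes "j \<ge> 1"
  shows "dilation j (sine_mode n) = sine_mode (j * n)"
proof -
  have "dilation j (sine_mode n) = abs_L2 (dilations (dilations sine n) j)"
    unfolding sine_mode_def
  proof (rule dilation_abs_L2_periodic[OF _ _ square_integrable_dilations_sine assms])
    fix x :: real
    have "sin (pi * (real n * (x + 2))) = sin (pi * (real n * x) + real n * (2 * pi))"
      by (simp add: algebra_simps)
    also have "\<dots> = sin (pi * (real n * x))"
      using sin.plus_of_nat[of "pi * (real n * x)" n] by simp
    finally show "dilations sine n (x + 2) = dilations sine n x"
      by (simp add: dilations_def sine_def)
  qed (simp add: dilations_def sine_def)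
  also have "dilations (dilations sine n) j = dilations sine (j * n)"
    by (simp add: dilations_def fun_eq_iff mult_ac)
  finally show ?thesis by (simp add: sine_mode_def)
qed

lemma sine_span_cases:
  assumes "X \<in> sine_span"
  obtains S c where "finite S" "S \<subseteq> {1..}" "X = (\<Sum>n\<in>S. scaleC (c n) (sine_mode n))"
proof -
  obtain t r where t: "finite t" "t \<subseteq> sine_mode ` {1..}" and X: "X = (\<Sum>v\<in>t. scaleC (r v) v)"
    using assms unfolding L2.span_explicit by blast
  \<comment> \<open>One index is selected for each vector of \<open>t\<close>, so that the sum over \<open>t\<close> can be reindexed.\<close>
  obtain S where S: "S \<subseteq> {1..}" "inj_on sine_mode S" "t = sine_mode ` S"
    using t(2) unfolding subset_image_inj by blast
  show thesis
  proof (rule that)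
    show "finite S" using t(1) S by (simp add: finite_image_iff)
    show "X = (\<Sum>n\<in>S. scaleC (r (sine_mode n)) (sine_mode n))"
      unfolding X S(3) using S(2) by (simp add: sum.reindex)
  qed (rule S(1))
qed

text \<open>
  Applying \<open>\<Sum>\<^sub>j\<^sub>\<in>\<^sub>F a\<^sub>j D\<^sub>j\<close> to \<open>\<Sum>\<^sub>n c\<^sub>n e\<^sub>n\<close> gives \<open>\<Sum> a\<^sub>j c\<^sub>n e\<^sub>j\<^sub>n\<close>, whose Dirichlet polynomial is the product of
  those of \<open>a\<close> and \<open>c\<close> since \<open>ln (j n) = ln j + ln n\<close>. A pointwise lower bound for the first factor passes
  to the means, and from the dense set of finite sums to all of \<open>L\<^sup>2\<close>.
\<close>
lemma dilation_polynomial_lower_bound: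
  fixes a :: "nat \<Rightarrow> complex"
  assumes F: "finite F" "F \<subseteq> {1..}" and \<mu>: "\<mu> \<ge> 0"
    and lower: "\<And>s::real. \<mu> \<le> norm (\<Sum>j\<in>F. a j * cis (s * ln (real j)))"
  shows "\<mu> * norm X \<le> norm (\<Sum>j\<in>F. scaleC (a j) (dilation j X))"
proof -
  have *: "\<mu> * norm X \<le> norm (\<Sum>j\<in>F. scaleC (a j) (dilation j X))"
    if X_in: "X \<in> sine_span" for X
  proof -
    obtain S c where S: "finite S" "S \<subseteq> {1..}" and X: "X = (\<Sum>n\<in>S. scaleC (c n) (sine_mode n))"
      by (rule sine_span_cases[OF X_in])
    have pos: "j \<ge> 1" "n \<ge> 1" if "j \<in> F" "n \<in> S" for j n using that F S by auto
    \<comment> \<open>This step keeps \<open>h ln (j n)\<close> below 1 for all \<open>j \<in> F\<close>, \<open>n \<in> S\<close>.\<close>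
    define h where "h = 1 / (1 + (\<Sum>j\<in>F. ln (real j)) + (\<Sum>n\<in>S. ln (real n)))"
    have lnF: "ln (real j) \<ge> 0" if "j \<in> F" for j using that F by auto
    have lnS: "ln (real n) \<ge> 0" if "n \<in> S" for n using that S by auto
    have s0: "(\<Sum>j\<in>F. ln (real j)) \<ge> 0" "(\<Sum>n\<in>S. ln (real n)) \<ge> 0"
      using lnF lnS by (auto intro: sum_nonneg)
    have h: "h > 0" using s0 by (simp add: h_def)
    have hle: "h * l < 2 * pi" if "l \<le> (\<Sum>j\<in>F. ln (real j)) + (\<Sum>n\<in>S. ln (real n))" for l
    proof -
      have "h * l \<le> 1" using s0 that by (simp add: h_def divide_le_eq)
      then show ?thesis using pi_gt3 by linarith
    qed
    have leF: "ln (real j) \<le> (\<Sum>j\<in>F. ln (real j))" if "j \<in> F" for j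
      using that F lnF by (intro member_le_sum) auto
    have leS: "ln (real n) \<le> (\<Sum>n\<in>S. ln (real n))" if "n \<in> S" for n
      using that S lnS by (intro member_le_sum) auto
    let ?P = "\<lambda>t. \<Sum>j\<in>F. a j * cis (real t * (h * ln (real j)))"
    let ?U = "\<lambda>t. \<Sum>n\<in>S. c n * cis (real t * (h * ln (real n)))"
    let ?V = "\<lambda>t. \<Sum>(j, n)\<in>F \<times> S. a j * c n * cis (real t * (h * ln (real (j * n))))"
    have V: "?V t = ?P t * ?U t" for t
    proof -
      have "?V t = (\<Sum>(j, n)\<in>F \<times> S. (a j * cis (real t * (h * ln (real j)))) * (c n * cis (real t * (h * ln (real n)))))"
      proof (intro sum.cong refl, clarify)
        fix j n assume "j \<in> F" "n \<in> S"
        then have "ln (real (j * n)) = ln (real j) + ln (real n)"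
          using pos[of j n] by (simp add: ln_mult)
        then show "a j * c n * cis (real t * (h * ln (real (j * n))))
            = (a j * cis (real t * (h * ln (real j)))) * (c n * cis (real t * (h * ln (real n))))"
          by (simp add: distrib_left flip: cis_mult)
      qed
      then show ?thesis by (simp add: sum_product sum.cartesian_product)
    qed
    have U_lim: "(\<lambda>T. (\<Sum>t<T. (norm (?U t))\<^sup>2) / real T) \<longlonglongrightarrow> 2 * (norm X)\<^sup>2"
      unfolding X
    proof (rule norm_sine_sum_mean)
      fix n assume "n \<in> S"
      then show "1 \<le> n" using S by auto
      show "h * ln (real n) < 2 * pi" using leS[OF \<open>n \<in> S\<close>] s0 by (intro hle) linarith
    qed (rule h)
    have "(\<lambda>T. (\<Sum>t<T. (norm (\<Sum>i\<in>F \<times> S. (case i of (j, n) \<Rightarrow> a j * c n) *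
          cis (real t * (h * ln (real (case i of (j, n) \<Rightarrow> j * n))))))\<^sup>2) / real T)
        \<longlonglongrightarrow> 2 * (norm (\<Sum>i\<in>F \<times> S. scaleC (case i of (j, n) \<Rightarrow> a j * c n)
              (sine_mode (case i of (j, n) \<Rightarrow> j * n))))\<^sup>2"
    proof (rule norm_sine_sum_mean)
      fix i assume "i \<in> F \<times> S"
      then obtain j n where i: "i = (j, n)" "j \<in> F" "n \<in> S" by auto
      then have "j \<ge> 1" "n \<ge> 1" using pos by auto
      then show "1 \<le> (case i of (j, n) \<Rightarrow> j * n)" using i by simp
      have "ln (real (j * n)) = ln (real j) + ln (real n)"
        using \<open>j \<ge> 1\<close> \<open>n \<ge> 1\<close> by (simp add: ln_mult)
      then have "h * ln (real (j * n)) < 2 * pi"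
        using leF[OF i(2)] leS[OF i(3)] by (intro hle) linarith
      then show "h * ln (real (case i of (j, n) \<Rightarrow> j * n)) < 2 * pi" using i by simp
    qed (rule h)
    also have "(\<Sum>i\<in>F \<times> S. scaleC (case i of (j, n) \<Rightarrow> a j * c n) (sine_mode (case i of (j, n) \<Rightarrow> j * n)))
        = (\<Sum>j\<in>F. scaleC (a j) (dilation j X))"
    proof -
      have "(\<Sum>j\<in>F. scaleC (a j) (dilation j X))
          = (\<Sum>j\<in>F. \<Sum>n\<in>S. scaleC (a j * c n) (sine_mode (j * n)))"
      proof (rule sum.cong[OF refl])
        fix j assume "j \<in> F"
        then have j: "j \<ge> 1" using F by auto
        show "scaleC (a j) (dilation j X) = (\<Sum>n\<in>S. scaleC (a j * c n) (sine_mode (j * n)))"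
          unfolding X
          by (simp add: linear_sum[OF bounded_linear.linear[OF bounded_linear_dilation[OF j]]]
              dilation_scaleC[OF j] dilation_sine_mode[OF j] L2.scale_sum_right)
      qed
      then show ?thesis by (simp add: sum.cartesian_product case_prod_beta)
    qed
    finally have V_lim: "(\<lambda>T. (\<Sum>t<T. (norm (?V t))\<^sup>2) / real T)
        \<longlonglongrightarrow> 2 * (norm (\<Sum>j\<in>F. scaleC (a j) (dilation j X)))\<^sup>2"
      by (simp add: case_prod_beta)
    have "\<mu>\<^sup>2 * (2 * (norm X)\<^sup>2) \<le> 2 * (norm (\<Sum>j\<in>F. scaleC (a j) (dilation j X)))\<^sup>2"
    proof (rule LIMSEQ_le[OF tendsto_mult_left[OF U_lim, of "\<mu>\<^sup>2"] V_lim], intro exI allI impI)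
      fix T :: nat
      have "\<mu>\<^sup>2 * (norm (?U t))\<^sup>2 \<le> (norm (?V t))\<^sup>2" for t
      proof -
        have "\<mu> \<le> norm (?P t)" using lower[of "real t * h"] by (simp add: mult.assoc)
        then show ?thesis unfolding V norm_mult power_mult_distrib
          using \<mu> by (intro mult_right_mono power_mono) auto
      qed
      then show "\<mu>\<^sup>2 * ((\<Sum>t<T. (norm (?U t))\<^sup>2) / real T) \<le> (\<Sum>t<T. (norm (?V t))\<^sup>2) / real T"
        unfolding times_divide_eq_right sum_distrib_left
        by (intro divide_right_mono sum_mono) auto
    qed
    then have "(\<mu> * norm X)\<^sup>2 \<le> (norm (\<Sum>j\<in>F. scaleC (a j) (dilation j X)))\<^sup>2"
      by (simp add: power_mult_distrib)
    then show ?thesis by (rule power2_le_imp_le) simp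
  qed
  have lin: "bounded_linear (\<lambda>X. \<Sum>j\<in>F. scaleC (a j) (dilation j X))"
    using F by (intro bounded_linear_sum bounded_linear_compose[OF bounded_linear_scaleC]
        bounded_linear_dilation) auto
  have "closed {X. \<mu> * norm X \<le> norm (\<Sum>j\<in>F. scaleC (a j) (dilation j X))}"
    by (intro closed_Collect_le continuous_intros
        linear_continuous_on[OF lin])
  then have "closure sine_span \<subseteq> {X. \<mu> * norm X \<le> norm (\<Sum>j\<in>F. scaleC (a j) (dilation j X))}"
    using * by (intro closure_minimal) auto
  then show ?thesis unfolding closure_sine_span by auto
qed

section \<open>The torus minimum\<close>

lemma primes_of_props:
  assumes "finite F" "F \<subseteq> {1..}"
  shows "set (primes_of F) = {p. prime p \<and> (\<exists>j\<in>F. p dvd j)}" "distinct (primes_of F)"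
proof -
  have "{p. prime p \<and> (\<exists>j\<in>F. p dvd j)} \<subseteq> {..Max F}"
  proof clarify
    fix p j assume "j \<in> F" "p dvd j"
    then have "p \<le> j" using assms(2) by (intro dvd_imp_le) auto
    also have "j \<le> Max F" using assms(1) \<open>j \<in> F\<close> by simp
    finally show "p \<le> Max F" .
  qed
  then have "finite {p. prime p \<and> (\<exists>j\<in>F. p dvd j)}" by (rule finite_subset) simp
  then show "set (primes_of F) = {p. prime p \<and> (\<exists>j\<in>F. p dvd j)}" "distinct (primes_of F)"
    by (simp_all add: primes_of_def)
qed

lemma ln_eq_sum_primes_of:
  assumes F: "finite F" "F \<subseteq> {1..}" and j: "j \<in> F"
  shows "ln (real j) = (\<Sum>i<length (primes_of F).
    real (multiplicity (primes_of F ! i) j) * ln (real (primes_of F ! i)))"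
proof -
  have j0: "j \<noteq> 0" using F j by auto
  have "real j = real (\<Prod>p\<in>prime_factors j. p ^ multiplicity p j)"
    using prod_prime_factors[OF j0] by simp
  also have "ln \<dots> = (\<Sum>p\<in>prime_factors j. ln (real p ^ multiplicity p j))"
    unfolding of_nat_prod of_nat_power
    by (intro ln_prod) (auto dest!: in_prime_factors_imp_prime prime_gt_0_nat)
  also have "\<dots> = (\<Sum>p\<in>prime_factors j. real (multiplicity p j) * ln (real p))"
    by (intro sum.cong refl ln_realpow)
  also have "\<dots> = (\<Sum>p\<in>set (primes_of F). real (multiplicity p j) * ln (real p))"
  proof (rule sum.mono_neutral_left)
    show "prime_factors j \<subseteq> set (primes_of F)"
      using j j0 by (auto simp: primes_of_props[OF F] prime_factors_dvd)
    show "\<forall>p\<in>set (primes_of F) - prime_factors j. real (multiplicity p j) * ln (real p) = 0"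
      using j0 by (auto simp: primes_of_props[OF F] prime_factors_dvd not_dvd_imp_multiplicity_0)
  qed simp
  also have "\<dots> = (\<Sum>i<length (primes_of F).
      real (multiplicity (primes_of F ! i) j) * ln (real (primes_of F ! i)))"
    by (rule sum.reindex_bij_betw[symmetric])
      (rule bij_betw_nth[OF primes_of_props(2)[OF F] refl refl])
  finally show ?thesis .
qed

lemma prod_cis: "(\<Prod>i\<in>I. cis (g i)) = cis (\<Sum>i\<in>I. g i)"
  by (induction I rule: infinite_finite_induct) (auto simp: cis_mult)

text \<open>
  By unique factorisation \<open>j\<^sup>i\<^sup>s\<close> is the monomial of \<open>j\<close> evaluated at the torus point \<open>w\<^sub>i = p\<^sub>i\<^sup>i\<^sup>s\<close>.
\<close>
lemma torus_min_le_dirichlet: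
  assumes F: "finite F" "F \<subseteq> {1..}"
  shows "torus_min a F \<le> norm (\<Sum>j\<in>F. a j * cis (s * ln (real j)))"
proof -
  let ?d = "length (primes_of F)"
  let ?p = "\<lambda>i. primes_of F ! i"
  define w where "w = (\<lambda>i\<in>{..<?d}. cis (s * ln (real (?p i))))"
  have "w \<in> torus ?d" by (auto simp: w_def torus_def)
  then have "torus_min a F \<le> norm (torus_poly a F w)"
    by (metis torus_min_attained)
  also have "torus_poly a F w = (\<Sum>j\<in>F. a j * cis (s * ln (real j)))"
    unfolding torus_poly_def
  proof (intro sum.cong refl)
    fix j assume j: "j \<in> F"
    have "(\<Prod>i<?d. w i ^ multiplicity (?p i) j)
        = (\<Prod>i<?d. cis (real (multiplicity (?p i) j) * (s * ln (real (?p i)))))"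
      by (intro prod.cong refl) (simp add: w_def Complex.DeMoivre)
    also have "\<dots> = cis (\<Sum>i<?d. real (multiplicity (?p i) j) * (s * ln (real (?p i))))"
      by (rule prod_cis)
    also have "(\<Sum>i<?d. real (multiplicity (?p i) j) * (s * ln (real (?p i)))) = s * ln (real j)"
      unfolding ln_eq_sum_primes_of[OF F j] sum_distrib_left by (intro sum.cong refl) simp
    finally show "a j * (\<Prod>i<?d. w i ^ multiplicity (?p i) j) = a j * cis (s * ln (real j))" by simp
  qed
  finally show ?thesis .
qed

section \<open>Perturbation of invertible operators\<close>

text \<open>
  Solving \<open>A x + B x = y\<close> means finding a fixed point of \<open>x \<mapsto> A\<^sup>-\<^sup>1 (y - B x)\<close>, which contracts by the factor
  \<open>\<beta> / \<mu>\<close>.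
\<close>
lemma surj_add_of_norm_less:
  fixes A B :: "'a :: banach \<Rightarrow> 'a"
  assumes A: "bounded_linear A" "surj A" "\<And>x. \<mu> * norm x \<le> norm (A x)"
    and B: "bounded_linear B" "\<And>x. norm (B x) \<le> \<beta> * norm x"
    and \<beta>: "0 \<le> \<beta>" "\<beta> < \<mu>"
  shows "surj (\<lambda>x. A x + B x)"
proof -
  interpret A: bounded_linear A by fact
  interpret B: bounded_linear B by fact
  have "\<exists>x. y = A x + B x" for y
  proof -
    define g where "g x = inv A (y - B x)" for x
    have Ag: "A (g x) = y - B x" for x using A(2) by (simp add: g_def surj_f_inv_f)
    have "dist (g x) (g x') \<le> \<beta> / \<mu> * dist x x'" for x x'
    proof -
      have "\<mu> * norm (g x - g x') \<le> norm (A (g x - g x'))" by (rule A(3))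
      also have "A (g x - g x') = B (x' - x)" by (simp add: A.diff B.diff Ag)
      also have "norm (B (x' - x)) \<le> \<beta> * norm (x' - x)" by (rule B(2))
      finally show ?thesis
        using \<beta> by (simp add: dist_norm norm_minus_commute field_simps)
    qed
    then have "\<exists>!x. g x = x"
      using \<beta> by (intro banach_fix_type[of "\<beta> / \<mu>"]) auto
    then obtain x where "g x = x" by blast
    then have "y = A x + B x" using Ag[of x] by simp
    then show ?thesis ..
  qed
  then show ?thesis unfolding surj_def by blast
qed

lemma homeomorphism_of_bounded_below:
  fixes T :: "'a :: real_normed_vector \<Rightarrow> 'b :: real_normed_vector"
  assumes T: "bounded_linear T" "surj T" and \<delta>: "\<delta> > 0" "\<And>x. \<delta> * norm x \<le> norm (T x)"
  shows "homeomorphism UNIV UNIV T (inv T)"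
proof -
  interpret T: bounded_linear T by fact
  have inj: "inj T"
  proof (rule injI)
    fix x y assume "T x = T y"
    then have "\<delta> * norm (x - y) \<le> 0" using \<delta>(2)[of "x - y"] by (simp add: T.diff)
    then show "x = y" using \<delta>(1) by (simp add: mult_le_0_iff)
  qed
  have TS: "T (inv T y) = y" for y using T(2) by (rule surj_f_inv_f)
  have ST: "inv T (T x) = x" for x using inj by (rule inv_f_f)
  have "bounded_linear (inv T)"
  proof (rule bounded_linear_intro[where K = "1 / \<delta>"])
    show "inv T (x + y) = inv T x + inv T y" for x y
      by (metis ST TS T.add)
    show "inv T (r *\<^sub>R x) = r *\<^sub>R inv T x" for r x
      by (metis ST TS T.scaleR)
    show "norm (inv T x) \<le> norm x * (1 / \<delta>)" for x
      using \<delta>(2)[of "inv T x"] \<delta>(1) by (simp add: TS field_simps)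
  qed
  then show ?thesis
    unfolding homeomorphism_def
    using T inj by (auto simp: TS ST linear_continuous_on intro!: surj_imp_inj_inv inj_imp_surj_inv)
qed

section \<open>Series of dilations\<close>

definition dilation_series :: "(nat \<Rightarrow> complex) \<Rightarrow> nat set \<Rightarrow> L2 \<Rightarrow> L2" where
  "dilation_series a J X = (\<Sum>\<^sub>\<infinity>j\<in>J. scaleC (a j) (dilation j X))"

lemma dilation_series_summable:
  assumes a: "(\<lambda>j. norm (a j)) summable_on J" and J: "J \<subseteq> {1..}"
  shows "(\<lambda>j. norm (scaleC (a j) (dilation j X))) summable_on J"
    and "(\<lambda>j. scaleC (a j) (dilation j X)) summable_on J"
proof -
  have eq: "norm (scaleC (a j) (dilation j X)) = norm (a j) * norm X" if "j \<in> J" for j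
    using that J by (subst norm_scaleC, subst norm_dilation) auto
  show 1: "(\<lambda>j. norm (scaleC (a j) (dilation j X))) summable_on J"
    using summable_on_cmult_left[OF a, of "norm X"] eq
    by (simp cong: summable_on_cong)
  then show "(\<lambda>j. scaleC (a j) (dilation j X)) summable_on J"
    by (rule abs_summable_summable)
qed

lemma
  assumes a: "(\<lambda>j. norm (a j)) summable_on J" and J: "J \<subseteq> {1..}"
  shows dilation_series_add:
      "dilation_series a J (X + Y) = dilation_series a J X + dilation_series a J Y"
    and dilation_series_scaleC: "dilation_series a J (scaleC c X) = scaleC c (dilation_series a J X)"
    and norm_dilation_series: "norm (dilation_series a J X) \<le> (\<Sum>\<^sub>\<infinity>j\<in>J. norm (a j)) * norm X"
proof -
  note summable = dilation_series_summable[OF assms]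
  have pos: "j \<ge> 1" if "j \<in> J" for j using that J by auto
  have "dilation_series a J (X + Y)
      = (\<Sum>\<^sub>\<infinity>j\<in>J. scaleC (a j) (dilation j X) + scaleC (a j) (dilation j Y))"
    unfolding dilation_series_def
    by (intro infsum_cong) (simp add: dilation_add[OF pos] L2.scale_right_distrib)
  then show "dilation_series a J (X + Y) = dilation_series a J X + dilation_series a J Y"
    unfolding dilation_series_def by (simp add: infsum_add summable)
  have "dilation_series a J (scaleC c X) = (\<Sum>\<^sub>\<infinity>j\<in>J. scaleC c (scaleC (a j) (dilation j X)))"
    unfolding dilation_series_def
    by (intro infsum_cong) (simp add: dilation_scaleC[OF pos] mult.commute)
  then show "dilation_series a J (scaleC c X) = scaleC c (dilation_series a J X)"
    unfolding dilation_series_def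
    using infsumI[OF has_sum_bounded_linear[OF bounded_linear_scaleC has_sum_infsum[OF summable(2)], of c X]]
    by (simp add: o_def)
  have "norm (dilation_series a J X) \<le> (\<Sum>\<^sub>\<infinity>j\<in>J. norm (scaleC (a j) (dilation j X)))"
    unfolding dilation_series_def by (rule norm_infsum_bound[OF summable(1)])
  also have "\<dots> = (\<Sum>\<^sub>\<infinity>j\<in>J. norm (a j) * norm X)"
    by (intro infsum_cong) (simp add: norm_scaleC norm_dilation[OF pos])
  also have "\<dots> = (\<Sum>\<^sub>\<infinity>j\<in>J. norm (a j)) * norm X"
    by (rule infsum_cmult_left) (use a in simp)
  finally show "norm (dilation_series a J X) \<le> (\<Sum>\<^sub>\<infinity>j\<in>J. norm (a j)) * norm X" .
qed

lemma bounded_linear_dilation_series: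
  assumes "(\<lambda>j. norm (a j)) summable_on J" "J \<subseteq> {1..}"
  shows "bounded_linear (dilation_series a J)"
  by (rule bounded_linear_intro[where K = "\<Sum>\<^sub>\<infinity>j\<in>J. norm (a j)"])
    (use norm_dilation_series[OF assms] in \<open>auto simp: dilation_series_add[OF assms]
      dilation_series_scaleC[OF assms] scaleR_eq_scaleC mult.commute\<close>)

lemma dilation_series_finite:
  "finite J \<Longrightarrow> dilation_series a J X = (\<Sum>j\<in>J. scaleC (a j) (dilation j X))"
  by (simp add: dilation_series_def)

lemma dilation_series_split:
  assumes "(\<lambda>j. norm (a j)) summable_on J" "J \<subseteq> {1..}" "K \<subseteq> J"
  shows "dilation_series a J X = dilation_series a K X + dilation_series a (J - K) X"
proof -
  have "(\<lambda>j. scaleC (a j) (dilation j X)) summable_on J"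
    by (rule dilation_series_summable(2)[OF assms(1,2)])
  then have "(\<lambda>j. scaleC (a j) (dilation j X)) summable_on K"
    "(\<lambda>j. scaleC (a j) (dilation j X)) summable_on (J - K)"
    using assms(3) by (auto intro: summable_on_subset_banach)
  then have "dilation_series a (K \<union> (J - K)) X = dilation_series a K X + dilation_series a (J - K) X"
    unfolding dilation_series_def by (intro infsum_Un_disjoint) auto
  moreover have "K \<union> (J - K) = J" using assms(3) by auto
  ultimately show ?thesis by simp
qed

lemma dilation_1: "dilation 1 X = X"
proof -
  obtain u where u: "square_integrable u" "X = abs_L2 u" by (rule L2_exhaust)
  have b: "branch 1 0 x = x" for x by (simp add: branch_def branch_sign_def branch_shift_def)
  have "abs_L2 (odd_dilate 1 u) = abs_L2 u"
  proof (rule abs_L2_eqI[OF square_integrable_odd_dilate[OF u(1)] u(1)])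
    show "AE x in M01. odd_dilate 1 u x = u x"
    proof (rule AE_I2)
      fix x assume "x \<in> space M01"
      then show "odd_dilate 1 u x = u x"
        using odd_dilate_eq[of 1 0 x u] unfolding b by (simp add: branch_sign_def)
    qed
  qed simp
  then show ?thesis by (simp add: u dilation_abs_L2 del: One_nat_def)
qed

lemma inner_abs_L2_sine_mode:
  assumes f: "square_integrable f"
  shows "abs_L2 f \<bullet> scaleC c (sine_mode n) = (fourier_sin f n \<bullet> c) / 2"
proof -
  let ?s = "\<lambda>x. complex_of_real (sin (real n * pi * x))"
  have s: "dilations sine n = ?s" by (simp add: fun_eq_iff dilations_def sine_def mult_ac)
  have ss: "square_integrable ?s" using square_integrable_dilations_sine[of n] by (simp add: s)
  have [measurable]: "f \<in> borel_measurable M01" "?s \<in> borel_measurable M01"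
    using f ss by (auto simp: square_integrable_def)
  have int: "integrable M01 (\<lambda>x. f x * ?s x)"
  proof (rule Bochner_Integration.integrable_bound)
    show "integrable M01 (\<lambda>x. (norm (f x))\<^sup>2 + (norm (?s x))\<^sup>2)"
      using f ss by (auto simp: square_integrable_def)
    show "AE x in M01. norm (f x * ?s x) \<le> norm ((norm (f x))\<^sup>2 + (norm (?s x))\<^sup>2)"
    proof (rule AE_I2)
      fix x
      have "2 * norm (f x) * norm (?s x) \<le> (norm (f x))\<^sup>2 + (norm (?s x))\<^sup>2"
        by (rule sum_squares_bound)
      moreover have "0 \<le> norm (f x) * norm (?s x)" by simp
      ultimately have "norm (f x) * norm (?s x) \<le> (norm (f x))\<^sup>2 + (norm (?s x))\<^sup>2" by linarith
      then show "norm (f x * ?s x) \<le> norm ((norm (f x))\<^sup>2 + (norm (?s x))\<^sup>2)"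
        unfolding norm_mult real_norm_def by (rule order_trans[OF _ abs_ge_self])
    qed
  qed measurable
  have "abs_L2 f \<bullet> scaleC c (sine_mode n) = (\<integral>x. f x \<bullet> (c * ?s x) \<partial>M01)"
    unfolding sine_mode_def s
    by (simp add: inner_abs_L2 f square_integrable_scale ss flip: abs_L2_scale)
  also have "(\<lambda>x. f x \<bullet> (c * ?s x)) = (\<lambda>x. (f x * ?s x) \<bullet> c)"
    by (simp add: fun_eq_iff inner_complex_def algebra_simps)
  also have "(\<integral>x. (f x * ?s x) \<bullet> c \<partial>M01) = (\<integral>x. f x * ?s x \<partial>M01) \<bullet> c"
    using int by (intro integral_inner_left) auto
  also have "\<dots> = (fourier_sin f n \<bullet> c) / 2"
    by (simp add: fourier_sin_def inner_complex_def)
  finally show ?thesis .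
qed

text \<open>
  The inner product is the real part of the usual one, so orthogonality is required for all complex
  multiples of the sine functions.
\<close>
lemma orthogonal_sine_modes_imp_0:
  assumes "\<And>n c. n \<ge> 1 \<Longrightarrow> X \<bullet> scaleC c (sine_mode n) = 0"
  shows "X = 0"
proof -
  have "X \<bullet> Y = 0" if "Y \<in> sine_span" for Y
  proof (rule sine_span_cases[OF that])
    fix S c assume "finite S" "S \<subseteq> {1..}" "Y = (\<Sum>n\<in>S. scaleC (c n) (sine_mode n))"
    then show ?thesis using assms by (auto simp: inner_sum_right intro!: sum.neutral)
  qed
  moreover have "closed {Y. X \<bullet> Y = 0}" by (intro closed_Collect_eq continuous_intros)
  ultimately have "closure sine_span \<subseteq> {Y. X \<bullet> Y = 0}" by (intro closure_minimal) auto
  then have "X \<in> {Y. X \<bullet> Y = 0}" unfolding closure_sine_span by blast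
  then show ?thesis by simp
qed

text \<open>
  The series converges absolutely, and its sum has the same sine coefficients as \<open>f\<close>. By completeness of
  the sine system the two agree.
\<close>
lemma sine_expansion:
  assumes f: "square_integrable f" and a: "(\<lambda>j. norm (fourier_sin f j)) summable_on {1..}"
  shows "((\<lambda>j. scaleC (fourier_sin f j) (sine_mode j)) has_sum abs_L2 f) {1..}"
proof -
  let ?a = "fourier_sin f"
  have "(\<lambda>j. scaleC (?a j) (dilation j (sine_mode 1))) summable_on {1..} \<longleftrightarrow>
      (\<lambda>j. scaleC (?a j) (sine_mode j)) summable_on {1..}"
    by (intro summable_on_cong) (simp add: dilation_sine_mode)
  then have sm: "(\<lambda>j. scaleC (?a j) (sine_mode j)) summable_on {1..}"
    using dilation_series_summable(2)[OF a order_refl, of "sine_mode 1"] by blast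
  define g where "g = (\<Sum>\<^sub>\<infinity>j\<in>{1..}. scaleC (?a j) (sine_mode j))"
  have "g \<bullet> scaleC c (sine_mode n) = (?a n \<bullet> c) / 2" if n: "n \<ge> 1" for n c
  proof -
    have "g \<bullet> scaleC c (sine_mode n)
        = (\<Sum>\<^sub>\<infinity>j\<in>{1..}. scaleC (?a j) (sine_mode j) \<bullet> scaleC c (sine_mode n))"
      unfolding g_def
      using infsumI[OF has_sum_bounded_linear[OF bounded_linear_inner_left has_sum_infsum[OF sm],
          of "scaleC c (sine_mode n)"]]
      by (simp add: o_def)
    also have "\<dots> = (\<Sum>\<^sub>\<infinity>j\<in>{n}. scaleC (?a j) (sine_mode j) \<bullet> scaleC c (sine_mode n))"
      by (rule infsum_cong_neutral) (use n in \<open>auto simp: inner_sine_mode\<close>)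
    finally show ?thesis using n by (simp add: inner_sine_mode)
  qed
  then have "abs_L2 f - g = 0"
    using f by (intro orthogonal_sine_modes_imp_0) (simp add: inner_diff_left inner_abs_L2_sine_mode)
  then show ?thesis using has_sum_infsum[OF sm] by (simp add: g_def)
qed

text \<open>
  \<open>D\<^sub>j e\<^sub>n = e\<^sub>j\<^sub>n = D\<^sub>n e\<^sub>j\<close>, so applying the series to \<open>e\<^sub>n\<close> is the same as applying \<open>D\<^sub>n\<close> to the sine
  expansion of \<open>f\<close>.
\<close>
lemma dilation_series_sine_mode:
  assumes periodic: "\<And>x. f (x + 2) = f x"
    and odd: "AE x in lebesgue. f (- x) = - f x"
    and f: "square_integrable f" and a: "(\<lambda>j. norm (fourier_sin f j)) summable_on {1..}"
    and n: "n \<ge> 1"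
  shows "dilation_series (fourier_sin f) {1..} (sine_mode n) = abs_L2 (dilations f n)"
proof -
  let ?a = "fourier_sin f"
  have "((\<lambda>j. dilation n (scaleC (?a j) (sine_mode j))) has_sum dilation n (abs_L2 f)) {1..}"
    using has_sum_bounded_linear[OF bounded_linear_dilation[OF n] sine_expansion[OF f a]]
    by (simp add: o_def)
  then have "dilation n (abs_L2 f) = (\<Sum>\<^sub>\<infinity>j\<in>{1..}. dilation n (scaleC (?a j) (sine_mode j)))"
    by (simp add: infsumI)
  also have "\<dots> = dilation_series ?a {1..} (sine_mode n)"
    unfolding dilation_series_def
    using n by (intro infsum_cong) (simp add: dilation_scaleC dilation_sine_mode mult.commute)
  finally show ?thesis
    using dilation_abs_L2_periodic[of f, OF periodic odd f n] by simp
qed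

section \<open>Full equivalence\<close>

theorem lemma2p1:
  fixes f :: "real \<Rightarrow> complex" and \<phi> :: "nat \<Rightarrow> real" and F :: "nat set" and k :: nat
  assumes periodic: "\<And>x. f (x + 2) = f x"
    and odd: "AE x in lebesgue. f (- x) = - f x"
    and L2: "square_integrable f"
    and bound: "\<And>j. j \<ge> 1 \<Longrightarrow> norm (fourier_sin f j) \<le> \<phi> j"
    and l1: "(\<lambda>j. \<bar>\<phi> j\<bar>) summable_on {1..}"
    and F: "finite F" "F \<subseteq> {1..}" "1 \<in> F"
    and k: "k \<ge> 1"
    and coeff1_real: "fourier_sin f 1 \<in> \<real>"
    and dominant: "(\<Sum>j\<in>F - {1}. norm (fourier_sin f j)) < Re (fourier_sin f 1)"
    and positive: "torus_min (fourier_sin f) F - (\<Sum>\<^sub>\<infinity>j\<in>{1..}. \<phi> j)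
        + (\<Sum>j\<in>F. norm (fourier_sin f j)) + (\<Sum>j=1..k. \<phi> j - norm (fourier_sin f j)) > 0"
  shows "fully_equivalent (dilations f) (dilations sine)"
proof -
  define a where "a = fourier_sin f"
  define \<mu> where "\<mu> = torus_min a F"
  let ?D = "dilation_series a"
  have \<phi>: "\<phi> summable_on {1..}"
    by (rule abs_summable_summable) (use l1 in simp)
  have na: "(\<lambda>j. norm (a j)) summable_on {1..}"
    by (rule Infinite_Sum.abs_summable_on_comparison_test'[OF \<phi>]) (simp add: a_def bound)
  have na_sub: "(\<lambda>j. norm (a j)) summable_on J" "\<phi> summable_on J" if "J \<subseteq> {1..}" for J
    by (rule summable_on_subset_banach[OF na that] summable_on_subset_banach[OF \<phi> that])+
  define \<beta> where "\<beta> = (\<Sum>\<^sub>\<infinity>j\<in>{1..} - F. norm (a j))"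
  have \<beta>0: "\<beta> \<ge> 0" unfolding \<beta>_def by (rule infsum_nonneg) simp
  \<comment> \<open>Both \<open>F\<close> and \<open>{1..k}\<close> cut the positive integers into a finite and an infinite part; comparing the two
    expressions for the total sum of the coefficients brings in \<open>\<phi>\<close> only beyond \<open>k\<close>.\<close>
  have \<beta>\<mu>: "\<beta> < \<mu>"
  proof -
    have split: "(\<Sum>\<^sub>\<infinity>j\<in>{1..}. g j) = (\<Sum>j\<in>G. g j) + (\<Sum>\<^sub>\<infinity>j\<in>{1..} - G. g j)"
      if "g summable_on {1..}" "finite G" "G \<subseteq> {1..}" for g :: "nat \<Rightarrow> real" and G
    proof -
      have "(\<Sum>\<^sub>\<infinity>j\<in>G \<union> ({1..} - G). g j) = (\<Sum>\<^sub>\<infinity>j\<in>G. g j) + (\<Sum>\<^sub>\<infinity>j\<in>{1..} - G. g j)"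
        using that by (intro infsum_Un_disjoint summable_on_subset_banach[OF that(1)]) auto
      moreover have "G \<union> ({1..} - G) = {1..}" using that by auto
      ultimately show ?thesis using that(2) by simp
    qed
    have "(\<Sum>\<^sub>\<infinity>j\<in>{1..} - {1..k}. norm (a j)) \<le> (\<Sum>\<^sub>\<infinity>j\<in>{1..} - {1..k}. \<phi> j)"
      by (rule infsum_mono) (auto simp: a_def bound intro!: na_sub[unfolded a_def])
    moreover have "(\<Sum>j\<in>F. norm (a j)) + \<beta>
        = (\<Sum>j=1..k. norm (a j)) + (\<Sum>\<^sub>\<infinity>j\<in>{1..} - {1..k}. norm (a j))"
      unfolding \<beta>_def using split[OF na, of F] split[OF na, of "{1..k}"] F by simp
    moreover have "(\<Sum>\<^sub>\<infinity>j\<in>{1..}. \<phi> j) = (\<Sum>j=1..k. \<phi> j) + (\<Sum>\<^sub>\<infinity>j\<in>{1..} - {1..k}. \<phi> j)"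
      by (rule split[OF \<phi>]) auto
    ultimately show ?thesis
      using positive by (simp add: a_def \<mu>_def sum_subtractf)
  qed
  have lin_D: "bounded_linear (?D J)" if "J \<subseteq> {1..}" for J
    using na_sub(1)[OF that] that by (rule bounded_linear_dilation_series)
  have A_lower: "\<mu> * norm X \<le> norm (?D F X)" for X
    unfolding dilation_series_finite[OF F(1)]
    using F \<beta>0 \<beta>\<mu> torus_min_le_dirichlet[OF F(1,2), of a]
    by (intro dilation_polynomial_lower_bound) (auto simp: \<mu>_def)
  have A_surj: "surj (?D F)"
  proof -
    have a1: "a 1 \<noteq> 0" "norm (a 1) = Re (a 1)" 
    proof -
      have "0 \<le> (\<Sum>j\<in>F - {1}. norm (a j))" by (rule sum_nonneg) simp
      then have "Re (a 1) > 0" using dominant by (simp add: a_def)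
      then show "a 1 \<noteq> 0" "norm (a 1) = Re (a 1)"
        using coeff1_real by (auto simp: a_def complex_is_Real_iff cmod_eq_Re)
    qed
    have "surj (\<lambda>X. scaleC (a 1) X + ?D (F - {1}) X)"
    proof (rule surj_add_of_norm_less)
      show "bounded_linear (scaleC (a 1))" by (rule bounded_linear_scaleC)
      show "surj (scaleC (a 1))"
        by (rule surjI[of _ "scaleC (inverse (a 1))"]) (use a1 in simp)
      show "norm (a 1) * norm X \<le> norm (scaleC (a 1) X)" for X by (simp add: norm_scaleC)
      show "bounded_linear (?D (F - {1}))" using F by (intro lin_D) auto
      show "norm (?D (F - {1}) X) \<le> (\<Sum>j\<in>F - {1}. norm (a j)) * norm X" for X
        using norm_dilation_series[OF na_sub(1), of "F - {1}" X] F by (auto simp: infsum_finite)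
      show "0 \<le> (\<Sum>j\<in>F - {1}. norm (a j))" by (rule sum_nonneg) simp
      show "(\<Sum>j\<in>F - {1}. norm (a j)) < norm (a 1)"
        using dominant a1 by (simp add: a_def)
    qed
    moreover have "?D F X = scaleC (a 1) X + ?D (F - {1}) X" for X
    proof -
      have "?D F X = ?D {1} X + ?D (F - {1}) X"
        using F by (intro dilation_series_split na_sub) auto
      then show ?thesis by (simp add: dilation_series_finite dilation_1 del: One_nat_def)
    qed
    ultimately show ?thesis by simp
  qed
  have T_split: "?D {1..} X = ?D F X + ?D ({1..} - F) X" for X
    using F by (intro dilation_series_split na) auto
  have B_upper: "norm (?D ({1..} - F) X) \<le> \<beta> * norm X" for X
    unfolding \<beta>_def by (rule norm_dilation_series) (auto intro: na_sub)
  have "surj (\<lambda>X. ?D F X + ?D ({1..} - F) X)"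
    using F by (intro surj_add_of_norm_less[OF _ A_surj A_lower _ B_upper \<beta>0 \<beta>\<mu>] lin_D) auto
  then have T_surj: "surj (?D {1..})" by (simp only: T_split[symmetric])
  have T_lower: "(\<mu> - \<beta>) * norm X \<le> norm (?D {1..} X)" for X
    using A_lower[of X] B_upper[of X] norm_diff_ineq[of "?D F X" "?D ({1..} - F) X"]
    unfolding T_split by (simp add: left_diff_distrib)
  have hom: "homeomorphism UNIV UNIV (?D {1..}) (inv (?D {1..}))"
    by (rule homeomorphism_of_bounded_below[OF lin_D T_surj _ T_lower]) (use \<beta>\<mu> in auto)
  have lin: "Vector_Spaces.linear scaleC scaleC (?D {1..})"
    unfolding Vector_Spaces.linear_iff
    using vector_space_scaleC dilation_series_add[OF na order_refl]
      dilation_series_scaleC[OF na order_refl] by blast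
  have "square_integrable (dilations f n) \<and> square_integrable (dilations sine n)" if "n \<ge> 1" for n
    using square_integrable_dilations[of f, OF periodic odd L2 that] square_integrable_dilations_sine
    by blast
  moreover have "?D {1..} (abs_L2 (dilations sine n)) = abs_L2 (dilations f n)" if "n \<ge> 1" for n
    using dilation_series_sine_mode[of f, OF periodic odd L2 na[unfolded a_def] that]
    by (simp add: a_def sine_mode_def)
  ultimately show ?thesis
    unfolding fully_equivalent_def using lin hom by blast
qed

end
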